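(* Consider an ensemble of static team problems with parameters $Q,W,\{R_n\},\{\xi_n\}$, where each $\xi_n\in\mathbb{R}^n$ is an isotropic random vector with log-concave density and each $R_n$ is uniformly distributed on $V_{n,\ell}$, independent of $\{\xi_k\}$; let $\gamma_n^*$ be the solution of the $n$-th problem. Let $\zeta\sim\mathcal{N}(0,I_\ell)$ and let $\gamma_G$ be the solution of the Gaussian problem. Let $n\in\mathbb{N}$ be such that $n\ge \ell^{1/c_1}$ and $\frac{C}{n^{c_3}}<1$. Then with probability (over $R_n$) at least $1-C\exp(-n^{c_2})$, the ($R_n$-dependent) quantity $J(\gamma_n^*;\xi_n)$ satisfies the deterministic bounds $$J(\gamma_G;\zeta)\ \ge\ J(\gamma_n^*;\xi_n)\ \ge\ v_n-\frac{\frac{C}{n^{c_3}}}{1-\frac{C}{n^{c_3}}}\,J(\gamma_G;\zeta).$$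
   Context: A random vector $X\in\mathbb{R}^n$ is isotropic if $\mathbb{E}[X]=0$ and its covariance matrix is $I_n$. A density $f$ on $\mathbb{R}^n$ is log-concave if $f=\exp(-G)$ with $G$ convex. $V_{n,\ell}=\{R\in\mathbb{R}^{n\times\ell}: R^\top R=I_\ell\}$ is the Stiefel manifold, with its uniform (rotation-invariant) probability measure. $\varphi_\ell$ is the standard normal density on $\mathbb{R}^\ell$, and $f_Y$ is the density of $Y$. Universal constants. $C,c_1,c_2,c_3,c_4>0$ are fixed universal constants for which the following theorem of Eldan and Klartag holds: if $X$ is an isotropic random vector in $\mathbb{R}^n$ with log-concave density, $1\le \ell\le n^{c_1}$ is an integer, and $R$ is uniformly distributed on $V_{n,\ell}$ and independent of $X$, then with probability (over $R$) at least $1-C\exp(-n^{c_2})$ one has $\left|\frac{f_{R^\top X}(x)}{\varphi_\ell(x)}-1\right|\le \frac{C}{n^{c_3}}$ for all $x\in\mathbb{R}^\ell$ with $\|x\|\le n^{c_4}$ (here $f_{R^\top X}$ is the density of $R^\top X$ with $R$ held fixed). Ensemble of static team problems. Fix $m,\ell_1,\dots,\ell_m\in\mathbb{N}$, $\ell=m+\sum_{i=1}^m\ell_i$, a symmetric positive definite $Q\in\mathbb{R}^{m\times m}$, and $W\in\mathbb{R}^{\ell\times\ell}$, partitioned by rows as $W=[W_0;W_1;\dots;W_m]$ with $W_0\in\mathbb{R}^{m\times\ell}$, $W_i\in\mathbb{R}^{\ell_i\times\ell}$. The $n$-th problem ($n\geq \ell$) has random $R_n$ uniform on $V_{n,\ell}$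 (the $R_n$ independent of each other and of all other random variables), matrices $S=W_0R_n^\top$ and $H_i=W_iR_n^\top$ (with each $H_i$ of full row rank), environmental randomness $\xi_n$, and cost $L(u,\xi)=\frac12u^\top Qu+u^\top S\xi+\frac12\xi^\top S^\top Q^{-1}S\xi$. It consists in minimizing, for given $R_n$, $$J(\gamma;\xi_n)=\mathbb{E}\big[L(\gamma^1(H_1\xi_n),\dots,\gamma^m(H_m\xi_n),\xi_n)\big]$$ over all $\gamma=(\gamma^1,\dots,\gamma^m)$ with each $\gamma^i:\mathbb{R}^{\ell_i}\to\mathbb{R}$ measurable; the expectation is over $\xi_n$ only, so $\gamma_n^*$ and $J(\gamma_n^*;\xi_n)$ depend on $R_n$. Gaussian problem. For $\zeta\sim\mathcal{N}(0,I_\ell)$, $J(\gamma;\zeta)$ is the same expression with $\xi_n$ replaced by $\zeta$ and $R_n$ by $I_\ell$, i.e. $S=W_0$, $H_i=W_i$. $\gamma_G$ is its minimizer over measurable $\gamma$; it is known to be unique and linear. With $A_n=\{x\in\mathbb{R}^\ell:\|x\|\le n^{c_4}\}$, put $$J(\gamma;\zeta|A_n)=\mathbb{E}\big[\mathbb{I}_{\{\zeta\in A_n\}}L(\gamma^1(W_1\zeta),\dots,\gamma^m(W_m\zeta),\zeta)\big],\qquad v_n=\min_\gamma J(\gamma;\zeta|A_n),$$ the minimum being over all $\gamma=(\gamma^1,\dots,\gamma^m)$ with each $\gamma^i:\mathbb{R}^{\ell_i}\to\mathbb{R}$ measurable. *)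

theory Defs
  imports "HOL-Probability.Probability" "Jordan_Normal_Form.DL_Rank"
    "Jordan_Normal_Form.Gauss_Jordan_Elimination"
begin

unbundle no vec_syntax
unbundle no inner_syntax
hide_const (open) Finite_Cartesian_Product.vec Finite_Cartesian_Product.mat
  Cartesian_Space.rank Finite_Cartesian_Product.transpose

text \<open>
  The ambient dimension is a natural number that has to be quantified over inside formulas, so
  $R^n$ and the $n \times \ell$ matrices are the carriers \<open>carrier_vec n\<close> and \<open>carrier_mat n \<ell>\<close>.
  Coordinates, rows and agents are numbered from 0.
\<close>

subsection \<open>Measure theory on vectors and matrices\<close>

definition vec_borel :: "nat \<Rightarrow> real vec measure" where
  "vec_borel n = vimage_algebra (carrier_vec n) (\<lambda>x. \<lambda>i\<in>{..<n}. x $ i) (\<Pi>\<^sub>M i\<in>{..<n}. borel)"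

definition mat_borel :: "nat \<Rightarrow> nat \<Rightarrow> real mat measure" where
  "mat_borel n k = vimage_algebra (carrier_mat n k) (\<lambda>A. \<lambda>ij\<in>{..<n} \<times> {..<k}. A $$ ij)
     (\<Pi>\<^sub>M ij\<in>{..<n} \<times> {..<k}. borel)"

definition vec_lborel :: "nat \<Rightarrow> real vec measure" where
  "vec_lborel n = distr (\<Pi>\<^sub>M i\<in>{..<n}. lborel) (vec_borel n) (vec n)"

definition vec_norm :: "real vec \<Rightarrow> real" where
  "vec_norm x = sqrt (x \<bullet> x)"

lemma vec_measurable: "vec n \<in> measurable (\<Pi>\<^sub>M i\<in>{..<n}. lborel) (vec_borel n)"
proof -
  have "(\<lambda>x. \<lambda>i\<in>{..<n}. vec n x $ i) \<in> measurable (\<Pi>\<^sub>M i\<in>{..<n}. lborel) (\<Pi>\<^sub>M i\<in>{..<n}. borel)"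
    by (rule measurable_restrict) (auto intro: measurable_component_singleton)
  then show ?thesis
    unfolding vec_borel_def by (intro measurable_vimage_algebra2) auto
qed

subsection \<open>Random vectors\<close>

definition mean_vec :: "'a measure \<Rightarrow> nat \<Rightarrow> ('a \<Rightarrow> real vec) \<Rightarrow> real vec" where
  "mean_vec M n X = vec n (\<lambda>i. \<integral>\<omega>. X \<omega> $ i \<partial>M)"

definition cov_mat :: "'a measure \<Rightarrow> nat \<Rightarrow> ('a \<Rightarrow> real vec) \<Rightarrow> real mat" where
  "cov_mat M n X = mat n n (\<lambda>(i, j).
     \<integral>\<omega>. (X \<omega> $ i - mean_vec M n X $ i) * (X \<omega> $ j - mean_vec M n X $ j) \<partial>M)"

definition isotropic :: "'a measure \<Rightarrow> nat \<Rightarrow> ('a \<Rightarrow> real vec) \<Rightarrow> bool" where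
  "isotropic M n X \<longleftrightarrow> X \<in> measurable M (vec_borel n) \<and>
     (\<forall>i<n. integrable M (\<lambda>\<omega>. (X \<omega> $ i)\<^sup>2)) \<and>
     mean_vec M n X = 0\<^sub>v n \<and> cov_mat M n X = 1\<^sub>m n"

text \<open>
  As usual for log-concave densities, the convex function \<open>G\<close> may take the value \<open>\<infinity>\<close>, so that
  the density may vanish outside a convex set.
\<close>

definition exp_minus :: "ereal \<Rightarrow> real" where
  "exp_minus g = (if g = \<infinity> then 0 else exp (- real_of_ereal g))"

definition log_concave :: "nat \<Rightarrow> (real vec \<Rightarrow> real) \<Rightarrow> bool" where
  "log_concave n f \<longleftrightarrow> (\<exists>G :: real vec \<Rightarrow> ereal.
     (\<forall>x\<in>carrier_vec n. G x \<noteq> -\<infinity> \<and> f x = exp_minus (G x)) \<and>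
     (\<forall>x\<in>carrier_vec n. \<forall>y\<in>carrier_vec n. \<forall>t::real. 0 < t \<and> t < 1 \<longrightarrow>
        G ((1 - t) \<cdot>\<^sub>v x + t \<cdot>\<^sub>v y) \<le> ereal (1 - t) * G x + ereal t * G y))"

definition has_log_concave_density :: "'a measure \<Rightarrow> nat \<Rightarrow> ('a \<Rightarrow> real vec) \<Rightarrow> bool" where
  "has_log_concave_density M n X \<longleftrightarrow>
     (\<exists>f. log_concave n f \<and> distributed M (vec_lborel n) X (\<lambda>x. ennreal (f x)))"

definition std_normal_vec_density :: "nat \<Rightarrow> real vec \<Rightarrow> real" where
  "std_normal_vec_density l x = (\<Prod>i<l. std_normal_density (x $ i))"

text \<open>Independence of random elements with possibly different codomains.\<close>

definition indep_elements ::
  "'a measure \<Rightarrow> 'b measure \<Rightarrow> ('a \<Rightarrow> 'b) \<Rightarrow> 'c measure \<Rightarrow> ('a \<Rightarrow> 'c) \<Rightarrow> bool" where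
  "indep_elements M A X B Y \<longleftrightarrow> X \<in> measurable M A \<and> Y \<in> measurable M B \<and>
     prob_space.indep_set M {X -` S \<inter> space M |S. S \<in> sets A} {Y -` S \<inter> space M |S. S \<in> sets B}"

text \<open>The event that \<open>P\<close> holds need only contain a measurable event of probability at least \<open>p\<close>.\<close>

definition with_prob_at_least :: "'a measure \<Rightarrow> real \<Rightarrow> ('a \<Rightarrow> bool) \<Rightarrow> bool" where
  "with_prob_at_least M p P \<longleftrightarrow> (\<exists>E\<in>sets M. measure M E \<ge> p \<and> (\<forall>\<omega>\<in>E. P \<omega>))"

subsection \<open>The Stiefel manifold\<close>

definition stiefel :: "nat \<Rightarrow> nat \<Rightarrow> real mat set" where
  "stiefel n l = {R \<in> carrier_mat n l. R\<^sup>T * R = 1\<^sub>m l}"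

text \<open>
  Uniformity is invariance of the law under the action of the orthogonal group
  \<open>stiefel n n\<close>, which is transitive on \<open>stiefel n l\<close>.
\<close>

definition uniform_on_stiefel :: "'a measure \<Rightarrow> nat \<Rightarrow> nat \<Rightarrow> ('a \<Rightarrow> real mat) \<Rightarrow> bool" where
  "uniform_on_stiefel M n l R \<longleftrightarrow> R \<in> measurable M (mat_borel n l) \<and>
     (\<forall>\<omega>\<in>space M. R \<omega> \<in> stiefel n l) \<and>
     (\<forall>U\<in>stiefel n n. distr M (mat_borel n l) (\<lambda>\<omega>. U * R \<omega>) = distr M (mat_borel n l) R)"

subsection \<open>The constants of Eldan and Klartag\<close>

text \<open>
  The density of \<open>R\<^sup>T X\<close>, for the fixed matrix \<open>R \<omega>\<close>, is only determined up to null sets;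
  the pointwise estimate is asserted for some version \<open>f\<close> of it.
  The sample space \<open>real vec \<times> real mat\<close> is large enough to carry every joint law of \<open>(X, R)\<close>.
\<close>

definition eldan_klartag :: "real \<Rightarrow> real \<Rightarrow> real \<Rightarrow> real \<Rightarrow> real \<Rightarrow> bool" where
  "eldan_klartag C c1 c2 c3 c4 \<longleftrightarrow> C > 0 \<and> c1 > 0 \<and> c2 > 0 \<and> c3 > 0 \<and> c4 > 0 \<and>
     (\<forall>(n::nat) (l::nat) (M :: (real vec \<times> real mat) measure) X R.
        prob_space M \<longrightarrow> isotropic M n X \<longrightarrow> has_log_concave_density M n X \<longrightarrow>
        1 \<le> l \<longrightarrow> real l \<le> real n powr c1 \<longrightarrow>
        uniform_on_stiefel M n l R \<longrightarrow> indep_elements M (vec_borel n) X (mat_borel n l) R \<longrightarrow>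
        with_prob_at_least M (1 - C * exp (- (real n powr c2))) (\<lambda>\<omega>.
          \<exists>f. (\<forall>x. 0 \<le> f x) \<and>
              distributed M (vec_lborel l) (\<lambda>\<omega>'. (R \<omega>)\<^sup>T *\<^sub>v X \<omega>') (\<lambda>x. ennreal (f x)) \<and>
              (\<forall>x\<in>carrier_vec l. vec_norm x \<le> real n powr c4 \<longrightarrow>
                 \<bar>f x / std_normal_vec_density l x - 1\<bar> \<le> C / real n powr c3)))"

subsection \<open>Static team problems\<close>

definition total_dim :: "nat \<Rightarrow> (nat \<Rightarrow> nat) \<Rightarrow> nat" where
  "total_dim m ls = m + (\<Sum>i<m. ls i)"

definition W_env :: "nat \<Rightarrow> (nat \<Rightarrow> nat) \<Rightarrow> real mat \<Rightarrow> real mat" where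
  "W_env m ls W = mat m (total_dim m ls) (\<lambda>(r, c). W $$ (r, c))"

definition W_obs :: "nat \<Rightarrow> (nat \<Rightarrow> nat) \<Rightarrow> real mat \<Rightarrow> nat \<Rightarrow> real mat" where
  "W_obs m ls W i = mat (ls i) (total_dim m ls) (\<lambda>(r, c). W $$ (m + (\<Sum>j<i. ls j) + r, c))"

definition S_mat :: "nat \<Rightarrow> (nat \<Rightarrow> nat) \<Rightarrow> real mat \<Rightarrow> real mat \<Rightarrow> real mat" where
  "S_mat m ls W R = W_env m ls W * R\<^sup>T"

definition H_mat :: "nat \<Rightarrow> (nat \<Rightarrow> nat) \<Rightarrow> real mat \<Rightarrow> real mat \<Rightarrow> nat \<Rightarrow> real mat" where
  "H_mat m ls W R i = W_obs m ls W i * R\<^sup>T"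

definition full_row_rank :: "real mat \<Rightarrow> bool" where
  "full_row_rank A \<longleftrightarrow> vec_space.rank (dim_row A) A = dim_row A"

definition sym_pos_def :: "nat \<Rightarrow> real mat \<Rightarrow> bool" where
  "sym_pos_def m Q \<longleftrightarrow> Q \<in> carrier_mat m m \<and> Q\<^sup>T = Q \<and>
     (\<forall>u\<in>carrier_vec m. u \<noteq> 0\<^sub>v m \<longrightarrow> u \<bullet> (Q *\<^sub>v u) > 0)"

definition team_loss :: "real mat \<Rightarrow> real mat \<Rightarrow> real vec \<Rightarrow> real vec \<Rightarrow> real" where
  "team_loss Q S u x = 1/2 * (u \<bullet> (Q *\<^sub>v u)) + u \<bullet> (S *\<^sub>v x)
     + 1/2 * (x \<bullet> ((S\<^sup>T * the (mat_inverse Q) * S) *\<^sub>v x))"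

lemma sym_pos_def_inverse:
  assumes "sym_pos_def m Q"
  obtains P where "mat_inverse Q = Some P" "P \<in> carrier_mat m m" "Q * P = 1\<^sub>m m"
proof (cases "mat_inverse Q")
  case None
  have Q: "Q \<in> carrier_mat m m" using assms by (simp add: sym_pos_def_def)
  have "det Q \<noteq> 0"
  proof
    assume "det Q = 0"
    then obtain v where v: "v \<in> carrier_vec m" "v \<noteq> 0\<^sub>v m" "Q *\<^sub>v v = 0\<^sub>v m"
      using det_0_iff_vec_prod_zero[OF Q] by auto
    then have "v \<bullet> (Q *\<^sub>v v) > 0" using assms by (auto simp: sym_pos_def_def)
    then show False using v by simp
  qed
  then have "Q \<in> Units (ring_mat TYPE(real) m ())" by (rule det_non_zero_imp_unit[OF Q])
  then show thesis using mat_inverse(1)[OF Q None, where b = "()"] by blast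
next
  case (Some P)
  then show thesis
    using that mat_inverse(2)[of Q m P] assms by (auto simp: sym_pos_def_def)
qed

lemma team_loss_nonneg:
  assumes Q: "sym_pos_def m Q" and S: "S \<in> carrier_mat m k"
    and u: "u \<in> carrier_vec m" and x: "x \<in> carrier_vec k"
  shows "0 \<le> team_loss Q S u x"
proof -
  obtain P where P: "mat_inverse Q = Some P" "P \<in> carrier_mat m m" "Q * P = 1\<^sub>m m"
    using sym_pos_def_inverse[OF Q] by blast
  have Qc: "Q \<in> carrier_mat m m" and Qs: "Q\<^sup>T = Q" using Q by (auto simp: sym_pos_def_def)
  define y where "y = S *\<^sub>v x"
  define z where "z = P *\<^sub>v y"
  have y: "y \<in> carrier_vec m" using S x by (simp add: y_def)
  have z: "z \<in> carrier_vec m" using P(2) y by (simp add: z_def)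
  have Qz: "Q *\<^sub>v z = y"
    using assoc_mult_mat_vec[OF Qc P(2) y] P(3) y by (simp add: z_def)
  have "(S\<^sup>T * P * S) *\<^sub>v x = S\<^sup>T *\<^sub>v z"
  proof -
    have "S\<^sup>T * P \<in> carrier_mat k m" using S P(2) by simp
    then show ?thesis
      using assoc_mult_mat_vec[of "S\<^sup>T * P" k m S k x] assoc_mult_mat_vec[of "S\<^sup>T" k m P m y] S P(2) x y
      by (simp add: z_def y_def)
  qed
  then have quad: "x \<bullet> ((S\<^sup>T * the (mat_inverse Q) * S) *\<^sub>v x) = y \<bullet> z"
    using transpose_vec_mult_scalar[of "S\<^sup>T" k m z x] S x z
    by (simp add: P(1) y_def)
  have zQu: "z \<bullet> (Q *\<^sub>v u) = u \<bullet> y"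
    using transpose_vec_mult_scalar[of Q m m u z] Qc Qs Qz u z y
    by (simp add: comm_scalar_prod[OF y u])
  have "0 \<le> (u + z) \<bullet> (Q *\<^sub>v (u + z))"
  proof (cases "u + z = 0\<^sub>v m")
    case True then show ?thesis using Qc by simp
  next
    case False then show ?thesis using Q u z by (auto simp: sym_pos_def_def intro: less_imp_le)
  qed
  also have "(u + z) \<bullet> (Q *\<^sub>v (u + z)) = u \<bullet> (Q *\<^sub>v u) + 2 * (u \<bullet> y) + y \<bullet> z"
    using Qc u z y zQu Qz
    by (simp add: mult_add_distrib_mat_vec[OF Qc u z] add_scalar_prod_distrib[OF u z]
        scalar_prod_add_distrib[of _ m] comm_scalar_prod[OF z y])
  finally show ?thesis
    unfolding team_loss_def quad y_def[symmetric] by linarith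
qed

text \<open>A policy \<open>\<gamma>\<close> assigns to agent \<open>i < m\<close> the map \<open>\<gamma> i\<close> from \<open>carrier_vec (ls i)\<close> to the reals.\<close>

definition policies :: "nat \<Rightarrow> (nat \<Rightarrow> nat) \<Rightarrow> (nat \<Rightarrow> real vec \<Rightarrow> real) set" where
  "policies m ls = {\<gamma>. \<forall>i<m. \<gamma> i \<in> borel_measurable (vec_borel (ls i))}"

definition policy_loss :: "nat \<Rightarrow> (nat \<Rightarrow> nat) \<Rightarrow> real mat \<Rightarrow> real mat \<Rightarrow> real mat \<Rightarrow>
    (nat \<Rightarrow> real vec \<Rightarrow> real) \<Rightarrow> real vec \<Rightarrow> real" where
  "policy_loss m ls Q W R \<gamma> x =
     team_loss Q (S_mat m ls W R) (vec m (\<lambda>i. \<gamma> i (H_mat m ls W R i *\<^sub>v x))) x"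

text \<open>
  Completing the square, the loss equals
  \<open>(u + Q\<^sup>-\<^sup>1 S x)\<^sup>T Q (u + Q\<^sup>-\<^sup>1 S x) / 2 \<ge> 0\<close> (lemma \<open>team_loss_nonneg\<close>), so expected
  costs are integrals of nonnegative functions with values in \<open>[0, \<infinity>]\<close>. They are embedded into
  \<open>ereal\<close> so that differences of costs are not truncated at 0.
\<close>

definition team_cost :: "nat \<Rightarrow> (nat \<Rightarrow> nat) \<Rightarrow> real mat \<Rightarrow> real mat \<Rightarrow> real mat \<Rightarrow>
    'a measure \<Rightarrow> ('a \<Rightarrow> real vec) \<Rightarrow> (nat \<Rightarrow> real vec \<Rightarrow> real) \<Rightarrow> ereal" where
  "team_cost m ls Q W R M X \<gamma> = enn2ereal (\<integral>\<^sup>+ \<omega>. ennreal (policy_loss m ls Q W R \<gamma> (X \<omega>)) \<partial>M)"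

definition team_solution :: "nat \<Rightarrow> (nat \<Rightarrow> nat) \<Rightarrow> real mat \<Rightarrow> real mat \<Rightarrow> real mat \<Rightarrow>
    'a measure \<Rightarrow> ('a \<Rightarrow> real vec) \<Rightarrow> (nat \<Rightarrow> real vec \<Rightarrow> real) \<Rightarrow> bool" where
  "team_solution m ls Q W R M X \<gamma> \<longleftrightarrow> \<gamma> \<in> policies m ls \<and>
     (\<forall>\<gamma>'\<in>policies m ls. team_cost m ls Q W R M X \<gamma> \<le> team_cost m ls Q W R M X \<gamma>')"

text \<open>The Gaussian problem is the instance \<open>R = 1\<^sub>m (total_dim m ls)\<close>.\<close>

abbreviation gauss_cost :: "nat \<Rightarrow> (nat \<Rightarrow> nat) \<Rightarrow> real mat \<Rightarrow> real mat \<Rightarrow>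
    'a measure \<Rightarrow> ('a \<Rightarrow> real vec) \<Rightarrow> (nat \<Rightarrow> real vec \<Rightarrow> real) \<Rightarrow> ereal" where
  "gauss_cost m ls Q W \<equiv> team_cost m ls Q W (1\<^sub>m (total_dim m ls))"

abbreviation gauss_solution :: "nat \<Rightarrow> (nat \<Rightarrow> nat) \<Rightarrow> real mat \<Rightarrow> real mat \<Rightarrow>
    'a measure \<Rightarrow> ('a \<Rightarrow> real vec) \<Rightarrow> (nat \<Rightarrow> real vec \<Rightarrow> real) \<Rightarrow> bool" where
  "gauss_solution m ls Q W \<equiv> team_solution m ls Q W (1\<^sub>m (total_dim m ls))"

definition gauss_cost_on :: "nat \<Rightarrow> (nat \<Rightarrow> nat) \<Rightarrow> real mat \<Rightarrow> real mat \<Rightarrow> real vec set \<Rightarrow>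
    'a measure \<Rightarrow> ('a \<Rightarrow> real vec) \<Rightarrow> (nat \<Rightarrow> real vec \<Rightarrow> real) \<Rightarrow> ereal" where
  "gauss_cost_on m ls Q W A M Z \<gamma> = enn2ereal (\<integral>\<^sup>+ \<omega>.
     ennreal (indicator A (Z \<omega>) * policy_loss m ls Q W (1\<^sub>m (total_dim m ls)) \<gamma> (Z \<omega>)) \<partial>M)"

definition vec_ball :: "nat \<Rightarrow> real \<Rightarrow> real vec set" where
  "vec_ball l r = {x \<in> carrier_vec l. vec_norm x \<le> r}"

text \<open>The minimum \<open>v\<^sub>n\<close>, taken as an infimum so that it is meaningful without an attainment proof.\<close>

definition gauss_value_on :: "nat \<Rightarrow> (nat \<Rightarrow> nat) \<Rightarrow> real mat \<Rightarrow> real mat \<Rightarrow> real vec set \<Rightarrow>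
    'a measure \<Rightarrow> ('a \<Rightarrow> real vec) \<Rightarrow> ereal" where
  "gauss_value_on m ls Q W A M Z = (INF \<gamma>\<in>policies m ls. gauss_cost_on m ls Q W A M Z \<gamma>)"

definition team_ensemble :: "'a measure \<Rightarrow> nat \<Rightarrow> (nat \<Rightarrow> nat) \<Rightarrow> real mat \<Rightarrow> real mat \<Rightarrow>
    (nat \<Rightarrow> 'a \<Rightarrow> real mat) \<Rightarrow> (nat \<Rightarrow> 'a \<Rightarrow> real vec) \<Rightarrow> bool" where
  "team_ensemble M m ls Q W R \<xi> \<longleftrightarrow> prob_space M \<and> sym_pos_def m Q \<and>
     W \<in> carrier_mat (total_dim m ls) (total_dim m ls) \<and>
     (\<forall>k\<ge>total_dim m ls.
        \<xi> k \<in> measurable M (vec_borel k) \<and>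
        uniform_on_stiefel M k (total_dim m ls) (R k) \<and>
        (\<forall>\<omega>\<in>space M. \<forall>i<m. full_row_rank (H_mat m ls W (R k \<omega>) i))) \<and>
     prob_space.indep_vars M (\<lambda>k. mat_borel k (total_dim m ls)) R {total_dim m ls..} \<and>
     indep_elements M
       (\<Pi>\<^sub>M k\<in>{total_dim m ls..}. mat_borel k (total_dim m ls)) (\<lambda>\<omega>. \<lambda>k\<in>{total_dim m ls..}. R k \<omega>)
       (\<Pi>\<^sub>M k\<in>{total_dim m ls..}. vec_borel k) (\<lambda>\<omega>. \<lambda>k\<in>{total_dim m ls..}. \<xi> k \<omega>)"

end

theory Submission
  imports Defs
begin

text \<open>
  Completing the square, the loss of a policy is \<open>(u + Q\<^sup>-\<^sup>1 S \<xi>)\<^sup>T Q (u + Q\<^sup>-\<^sup>1 S \<xi>) / 2\<close>, and both \<open>S \<xi>\<close> and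
  the observations depend on \<open>\<xi>\<close> only through \<open>y = R\<^sup>T \<xi>\<close>. Hence every problem, the Gaussian one
  included, asks for the minimum of one and the same nonnegative function of policy and \<open>y\<close>,
  integrated against the law of \<open>y\<close> (\<open>team_cost_eq_law\<close>).

  Upper bound. For every \<open>R\<close> in the Stiefel manifold the vector \<open>R\<^sup>T \<xi>\<close> has the same second moments as
  \<open>\<zeta>\<close>, so a linear policy costs the same for both (\<open>linear_policy_cost_moments\<close>). It remains to
  see that in the Gaussian problem no policy beats all the linear ones (\<open>gauss_linear_policy_optimal\<close>).
  Replacing the action of each agent by its \<open>L\<^sup>2\<close>-projection onto the linear functions of \<open>\<zeta>\<close> does
  not increase the quadratic cost. The new action is still a function of the agent's observation
  \<open>W\<^sub>i \<zeta>\<close>, because a function of \<open>W\<^sub>i \<zeta>\<close> is uncorrelated with \<open>v \<bullet> \<zeta>\<close> whenever \<open>W\<^sub>i v = 0\<close>. This last fact,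
  usually deduced from rotation invariance, is obtained by differentiating the Cameron-Martin formula
  (\<open>gauss_orthogonal_invariant_direction\<close>). The upper bound therefore holds for every value of \<open>R\<close>.

  Lower bound. On the Eldan-Klartag event, the density of \<open>R\<^sup>T \<xi>\<close> is at least \<open>1 - \<epsilon>\<close> times the Gaussian
  density on the ball. The loss is nonnegative, so \<open>J(\<gamma>\<^sub>n\<^sup>*; \<xi>\<^sub>n) \<ge> (1 - \<epsilon>) J(\<gamma>\<^sub>n\<^sup>*; \<zeta>|A\<^sub>n) \<ge> (1 - \<epsilon>) v\<^sub>n\<close>
  (\<open>near_gauss_cost_lower_bound\<close>). Dividing by \<open>1 - \<epsilon>\<close>, \<open>v\<^sub>n\<close> exceeds \<open>J(\<gamma>\<^sub>n\<^sup>*; \<xi>\<^sub>n)\<close> by at most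
  \<open>\<epsilon> / (1 - \<epsilon>)\<close> times \<open>J(\<gamma>\<^sub>n\<^sup>*; \<xi>\<^sub>n)\<close> itself, which the upper bound replaces by the Gaussian optimum.
\<close>

section \<open>Measurability of vector-valued maps\<close>

lemma space_vec_borel [simp]: "space (vec_borel n) = carrier_vec n"
  by (simp add: vec_borel_def)

lemma sets_vec_lborel [simp, measurable_cong]: "sets (vec_lborel n) = sets (vec_borel n)"
  by (simp add: vec_lborel_def)

lemma space_vec_lborel [simp]: "space (vec_lborel n) = carrier_vec n"
  by (simp add: vec_lborel_def)

lemma measurable_vec_index [measurable (raw)]:
  assumes "X \<in> measurable M (vec_borel n)" and "i < n"
  shows "(\<lambda>\<omega>. X \<omega> $ i) \<in> borel_measurable M"
proof -
  have "(\<lambda>x. \<lambda>i\<in>{..<n}. x $ i) \<in> measurable (vec_borel n) (\<Pi>\<^sub>M i\<in>{..<n}. borel :: real measure)"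
    unfolding vec_borel_def by (rule measurable_vimage_algebra1) (auto simp: space_PiM)
  from measurable_compose[OF assms(1) this]
  have "(\<lambda>\<omega>. \<lambda>i\<in>{..<n}. X \<omega> $ i) \<in> measurable M (\<Pi>\<^sub>M i\<in>{..<n}. borel)" .
  from measurable_compose[OF this measurable_component_singleton[of i]] assms(2)
  show ?thesis by simp
qed

lemma measurable_vec_nth: "i < n \<Longrightarrow> (\<lambda>x. x $ i) \<in> borel_measurable (vec_borel n)"
  by (rule measurable_vec_index) auto

lemma measurable_vec_borelI:
  assumes "\<And>\<omega>. \<omega> \<in> space M \<Longrightarrow> X \<omega> \<in> carrier_vec n"
    and "\<And>i. i < n \<Longrightarrow> (\<lambda>\<omega>. X \<omega> $ i) \<in> borel_measurable M"
  shows "X \<in> measurable M (vec_borel n)"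
  unfolding vec_borel_def
  by (rule measurable_vimage_algebra2) (auto intro!: measurable_restrict assms)

lemma mult_mat_vec_index:
  assumes "A \<in> carrier_mat p n" "x \<in> carrier_vec n" "i < p"
  shows "(A *\<^sub>v x) $ i = (\<Sum>j<n. A $$ (i, j) * x $ j)"
  using assms by (auto simp: mult_mat_vec_def scalar_prod_def lessThan_atLeast0)

lemma measurable_mult_mat_vec:
  assumes A: "A \<in> carrier_mat p n" and X: "X \<in> measurable M (vec_borel n)"
  shows "(\<lambda>\<omega>. A *\<^sub>v X \<omega>) \<in> measurable M (vec_borel p)"
proof (rule measurable_vec_borelI)
  have car: "X \<omega> \<in> carrier_vec n" if "\<omega> \<in> space M" for \<omega>
    using measurable_space[OF X that] by simp
  show "A *\<^sub>v X \<omega> \<in> carrier_vec p" if "\<omega> \<in> space M" for \<omega>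
    using A car[OF that] by simp
  fix i assume i: "i < p"
  have "(\<lambda>\<omega>. \<Sum>j<n. A $$ (i, j) * X \<omega> $ j) \<in> borel_measurable M"
    using X by (intro borel_measurable_sum borel_measurable_times measurable_vec_index) auto
  then show "(\<lambda>\<omega>. (A *\<^sub>v X \<omega>) $ i) \<in> borel_measurable M"
    by (rule measurable_cong[THEN iffD1, rotated]) (simp add: mult_mat_vec_index[OF A car i])
qed

lemma measurable_add_vec:
  assumes "a \<in> carrier_vec n"
  shows "(\<lambda>x. x + a) \<in> measurable (vec_borel n) (vec_borel n)"
proof (rule measurable_vec_borelI)
  fix i assume i: "i < n"
  have "(\<lambda>x. x $ i + a $ i) \<in> borel_measurable (vec_borel n)"
    using i by (intro borel_measurable_add borel_measurable_const measurable_vec_nth)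
  then show "(\<lambda>x. (x + a) $ i) \<in> borel_measurable (vec_borel n)"
    by (rule measurable_cong[THEN iffD1, rotated]) (use i assms in auto)
qed (use assms in auto)

section \<open>The standard Gaussian measure and its translates\<close>

text \<open>
  A shifted box is again a box, with sides of the same length, and a measure on the product space
  is determined by its values on boxes.
\<close>

lemma PiM_lborel_translate:
  fixes a :: "nat \<Rightarrow> real"
  shows "distr (\<Pi>\<^sub>M i\<in>{..<n}. lborel) (\<Pi>\<^sub>M i\<in>{..<n}. lborel) (\<lambda>x. \<lambda>i\<in>{..<n}. x i + a i)
    = (\<Pi>\<^sub>M i\<in>{..<n}. lborel)"
proof -
  interpret product_sigma_finite "\<lambda>_::nat. lborel :: real measure"
    by standard
  have T: "(\<lambda>x. \<lambda>i\<in>{..<n}. x i + a i)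
      \<in> measurable (\<Pi>\<^sub>M i\<in>{..<n}. lborel) (\<Pi>\<^sub>M i\<in>{..<n}. lborel)"
    by (rule measurable_restrict) measurable
  show ?thesis
  proof (rule PiM_eqI)
    fix A :: "nat \<Rightarrow> real set"
    assume A: "\<And>i. i \<in> {..<n} \<Longrightarrow> A i \<in> sets lborel"
    have sh: "(\<lambda>y. y + a i) -` A i \<in> sets lborel" if "i \<in> {..<n}" for i
      using measurable_sets[of "\<lambda>y. y + a i" lborel lborel "A i"] A[OF that] by simp
    have em: "emeasure lborel ((\<lambda>y. y + a i) -` A i) = emeasure lborel (A i)" if "i \<in> {..<n}" for i
    proof -
      have "lborel = distr lborel borel (\<lambda>y. a i + y)"
        by (rule lborel_distr_plus[symmetric])
      then have "emeasure lborel (A i) = emeasure (distr lborel borel (\<lambda>y. a i + y)) (A i)"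
        by simp
      also have "\<dots> = emeasure lborel ((\<lambda>y. a i + y) -` A i \<inter> space lborel)"
        using A[OF that] by (intro emeasure_distr) auto
      finally show ?thesis by (simp add: add.commute)
    qed
    have "emeasure (distr (\<Pi>\<^sub>M i\<in>{..<n}. lborel) (\<Pi>\<^sub>M i\<in>{..<n}. lborel)
            (\<lambda>x. \<lambda>i\<in>{..<n}. x i + a i)) (Pi\<^sub>E {..<n} A)
        = emeasure (\<Pi>\<^sub>M i\<in>{..<n}. lborel)
            ((\<lambda>x. \<lambda>i\<in>{..<n}. x i + a i) -` Pi\<^sub>E {..<n} A \<inter> space (\<Pi>\<^sub>M i\<in>{..<n}. lborel))"
      using A by (intro emeasure_distr T sets_PiM_I_finite) auto
    also have "(\<lambda>x. \<lambda>i\<in>{..<n}. x i + a i) -` Pi\<^sub>E {..<n} A \<inter> space (\<Pi>\<^sub>M i\<in>{..<n}. lborel)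
        = Pi\<^sub>E {..<n} (\<lambda>i. (\<lambda>y. y + a i) -` A i)"
      by (auto simp: space_PiM PiE_iff)
    also have "emeasure (\<Pi>\<^sub>M i\<in>{..<n}. lborel) \<dots>
        = (\<Prod>i\<in>{..<n}. emeasure lborel ((\<lambda>y. y + a i) -` A i))"
      using sh by (intro emeasure_PiM) auto
    also have "\<dots> = (\<Prod>i\<in>{..<n}. emeasure lborel (A i))"
      by (intro prod.cong refl em)
    finally show "emeasure (distr (\<Pi>\<^sub>M i\<in>{..<n}. lborel) (\<Pi>\<^sub>M i\<in>{..<n}. lborel)
            (\<lambda>x. \<lambda>i\<in>{..<n}. x i + a i)) (Pi\<^sub>E {..<n} A) = (\<Prod>i\<in>{..<n}. emeasure lborel (A i))" .
  qed auto
qed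

lemma vec_lborel_translate:
  assumes a: "a \<in> carrier_vec n"
  shows "distr (vec_lborel n) (vec_borel n) (\<lambda>x. x + a) = vec_lborel n"
proof -
  let ?P = "\<Pi>\<^sub>M i\<in>{..<n}. lborel :: real measure"
  let ?T = "\<lambda>x. \<lambda>i\<in>{..<n}. x i + a $ i"
  have T: "?T \<in> measurable ?P ?P"
    by (rule measurable_restrict) measurable
  have "distr (vec_lborel n) (vec_borel n) (\<lambda>x. x + a)
      = distr ?P (vec_borel n) ((\<lambda>x. x + a) \<circ> vec n)"
    unfolding vec_lborel_def by (rule distr_distr[OF measurable_add_vec[OF a] vec_measurable])
  also have "(\<lambda>x. x + a) \<circ> vec n = vec n \<circ> ?T"
    using a by (auto simp: fun_eq_iff)
  also have "distr ?P (vec_borel n) (vec n \<circ> ?T) = distr (distr ?P ?P ?T) (vec_borel n) (vec n)"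
    by (rule distr_distr[OF vec_measurable T, symmetric])
  also have "\<dots> = vec_lborel n"
    by (simp add: PiM_lborel_translate vec_lborel_def)
  finally show ?thesis .
qed

text \<open>
  The law of \<open>\<zeta>\<close>. Every Gaussian cost depends on \<open>\<zeta>\<close> through its law alone, so the Gaussian problem
  is studied on this one measure.
\<close>

definition gauss :: "nat \<Rightarrow> real vec measure" where
  "gauss l = density (vec_lborel l) (\<lambda>x. ennreal (std_normal_vec_density l x))"

lemma sets_gauss [simp, measurable_cong]: "sets (gauss l) = sets (vec_borel l)"
  and space_gauss [simp]: "space (gauss l) = carrier_vec l"
  by (simp_all add: gauss_def)

lemma std_normal_vec_density_measurable [measurable]:
  "std_normal_vec_density l \<in> borel_measurable (vec_borel l)"
  unfolding std_normal_vec_density_def[abs_def]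
  by (intro borel_measurable_prod measurable_compose[OF measurable_vec_index borel_measurable_normal_density])
    auto

lemma std_normal_vec_density_pos: "0 < std_normal_vec_density l x"
  unfolding std_normal_vec_density_def by (intro prod_pos) (simp add: normal_density_pos)

lemma std_normal_vec_density_shift:
  assumes a: "a \<in> carrier_vec l" and x: "x \<in> carrier_vec l"
  shows "std_normal_vec_density l x
    = std_normal_vec_density l (x + a) * exp (a \<bullet> (x + a) - a \<bullet> a / 2)"
proof -
  have "std_normal_density s = std_normal_density (s + t) * exp (t * (s + t) - t * t / 2)" for s t :: real
    unfolding normal_density_def
    by (simp add: mult_exp_exp power2_eq_square field_simps)
  then have "std_normal_vec_density l x = (\<Prod>i<l. std_normal_density (x $ i + a $ i)
      * exp (a $ i * (x $ i + a $ i) - a $ i * a $ i / 2))"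
    unfolding std_normal_vec_density_def by (intro prod.cong) auto
  also have "\<dots> = std_normal_vec_density l (x + a)
      * exp (\<Sum>i<l. a $ i * (x $ i + a $ i) - a $ i * a $ i / 2)"
    using a x by (simp add: std_normal_vec_density_def prod.distrib exp_sum)
  also have "(\<Sum>i<l. a $ i * (x $ i + a $ i) - a $ i * a $ i / 2) = a \<bullet> (x + a) - a \<bullet> a / 2"
    using a x by (simp add: scalar_prod_def lessThan_atLeast0 sum_subtractf sum_divide_distrib)
  finally show ?thesis .
qed

lemma measurable_scalar_prod:
  assumes a: "a \<in> carrier_vec l"
  shows "(\<lambda>x. a \<bullet> x) \<in> borel_measurable (vec_borel l)"
proof -
  have "(\<lambda>x. \<Sum>i<l. a $ i * x $ i) \<in> borel_measurable (vec_borel l)"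
    by (intro borel_measurable_sum borel_measurable_times borel_measurable_const measurable_vec_nth) auto
  then show ?thesis
    by (rule measurable_cong[THEN iffD1, rotated])
      (use a in \<open>auto simp: scalar_prod_def lessThan_atLeast0\<close>)
qed

text \<open>
  The Cameron-Martin formula: Lebesgue measure does not see the shift, so only the quotient
  of the Gaussian density by its translate remains. It replaces the
  rotation invariance of the Gaussian law, which is harder to reach from a product measure.
\<close>

lemma gauss_translate:
  assumes a: "a \<in> carrier_vec l"
  shows "distr (gauss l) (vec_borel l) (\<lambda>x. x + a)
    = density (gauss l) (\<lambda>x. ennreal (exp (a \<bullet> x - a \<bullet> a / 2)))"
proof -
  note [measurable] = measurable_add_vec[OF a] measurable_scalar_prod[OF a]
  let ?h = "\<lambda>x. ennreal (std_normal_vec_density l x) * ennreal (exp (a \<bullet> x - a \<bullet> a / 2))"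
  have "gauss l = density (vec_lborel l) (\<lambda>x. ?h (x + a))"
    unfolding gauss_def
  proof (rule density_cong)
    show "AE x in vec_lborel l. ennreal (std_normal_vec_density l x) = ?h (x + a)"
      by (rule AE_I2)
        (simp add: std_normal_vec_density_shift[OF a] ennreal_mult[symmetric] std_normal_vec_density_pos less_imp_le)
  qed measurable
  then have "distr (gauss l) (vec_borel l) (\<lambda>x. x + a)
      = density (distr (vec_lborel l) (vec_borel l) (\<lambda>x. x + a)) ?h"
    by (subst density_distr) simp_all
  also have "\<dots> = density (gauss l) (\<lambda>x. ennreal (exp (a \<bullet> x - a \<bullet> a / 2)))"
    unfolding vec_lborel_translate[OF a] gauss_def by (subst density_density_eq) simp_all
  finally show ?thesis .
qed

lemma gauss_product_moment:
  fixes k :: "nat \<Rightarrow> nat"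
  shows "integrable (gauss l) (\<lambda>x. \<Prod>i<l. (x $ i) ^ k i)"
    and "(\<integral>x. (\<Prod>i<l. (x $ i) ^ k i) \<partial>gauss l)
      = (\<Prod>i<l. \<integral>s. std_normal_density s * s ^ k i \<partial>lborel)"
proof -
  interpret product_sigma_finite "\<lambda>_::nat. lborel :: real measure"
    by standard
  let ?P = "\<Pi>\<^sub>M i\<in>{..<l}. lborel :: real measure"
  let ?f = "\<lambda>x. \<Prod>i<l. (x $ i) ^ k i"
  have f [measurable]: "?f \<in> borel_measurable (vec_borel l)"
    by (intro borel_measurable_prod borel_measurable_power measurable_vec_index) auto
  have eq: "std_normal_vec_density l (vec l y) * ?f (vec l y)
      = (\<Prod>i<l. std_normal_density (y i) * y i ^ k i)" for y
    by (simp add: std_normal_vec_density_def prod.distrib)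
  have int: "integrable ?P (\<lambda>y. \<Prod>i\<in>{..<l}. std_normal_density (y i) * y i ^ k i)"
    by (rule product_integrable_prod) (auto intro: integrable_std_normal_moment)
  have "integrable (gauss l) ?f
      \<longleftrightarrow> integrable (vec_lborel l) (\<lambda>x. std_normal_vec_density l x * ?f x)"
    unfolding gauss_def
    by (subst integrable_density) (auto intro!: AE_I2 less_imp_le std_normal_vec_density_pos)
  also have "\<dots> \<longleftrightarrow> integrable ?P (\<lambda>y. std_normal_vec_density l (vec l y) * ?f (vec l y))"
    unfolding vec_lborel_def by (rule integrable_distr_eq[OF vec_measurable]) measurable
  finally show "integrable (gauss l) ?f"
    unfolding eq using int by simp
  have "integral\<^sup>L (gauss l) ?f = integral\<^sup>L (vec_lborel l) (\<lambda>x. std_normal_vec_density l x * ?f x)"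
    unfolding gauss_def
    by (subst integral_density) (auto intro!: AE_I2 less_imp_le std_normal_vec_density_pos)
  also have "\<dots> = integral\<^sup>L ?P (\<lambda>y. std_normal_vec_density l (vec l y) * ?f (vec l y))"
    unfolding vec_lborel_def by (rule integral_distr[OF vec_measurable]) measurable
  also have "\<dots> = (\<Prod>i\<in>{..<l}. \<integral>s. std_normal_density s * s ^ k i \<partial>lborel)"
    unfolding eq by (rule product_integral_prod) (auto intro: integrable_std_normal_moment)
  finally show "integral\<^sup>L (gauss l) ?f = (\<Prod>i<l. \<integral>s. std_normal_density s * s ^ k i \<partial>lborel)" .
qed

lemma prob_space_gauss: "prob_space (gauss l)"
proof
  have *: "integrable (gauss l) (\<lambda>x. 1 :: real)" "integral\<^sup>L (gauss l) (\<lambda>x. 1 :: real) = 1"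
    using gauss_product_moment[of l "\<lambda>_. 0"] integral_std_normal_moment_even[of 0] by simp_all
  have "emeasure (gauss l) (space (gauss l)) = (\<integral>\<^sup>+ x. ennreal 1 \<partial>gauss l)"
    by simp
  also have "\<dots> = ennreal (integral\<^sup>L (gauss l) (\<lambda>x. 1 :: real))"
    by (rule nn_integral_eq_integral[OF *(1)]) simp
  finally show "emeasure (gauss l) (space (gauss l)) = 1"
    using *(2) by simp
qed

lemma gauss_second_moment:
  assumes i: "i < l" and j: "j < l"
  shows "integrable (gauss l) (\<lambda>x. x $ i * x $ j)"
    and "(\<integral>x. x $ i * x $ j \<partial>gauss l) = (if i = j then 1 else 0)"
proof -
  let ?k = "\<lambda>r. (if r = i then 1 else 0) + (if r = j then 1 else (0::nat))"
  have eq: "(\<Prod>r<l. (x $ r) ^ ?k r) = x $ i * x $ j" for x :: "real vec"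
  proof -
    have "(\<Prod>r<l. (x $ r) ^ ?k r) = (\<Prod>r<l. if r = i then x $ r else 1) * (\<Prod>r<l. if r = j then x $ r else 1)"
      unfolding prod.distrib[symmetric] by (intro prod.cong) auto
    then show ?thesis using i j by simp
  qed
  show "integrable (gauss l) (\<lambda>x. x $ i * x $ j)"
    using gauss_product_moment(1)[of l ?k] unfolding eq .
  have m: "(\<integral>s. std_normal_density s * s ^ 0 \<partial>lborel) = 1" "(\<integral>s. std_normal_density s * s ^ 1 \<partial>lborel) = 0"
    "(\<integral>s. std_normal_density s * s ^ 2 \<partial>lborel) = 1"
    using integral_std_normal_moment_even[of 0] integral_std_normal_moment_odd[of 0]
      integral_std_normal_moment_even[of 1] by (simp_all add: fact_numeral)
  have "(\<integral>x. x $ i * x $ j \<partial>gauss l) = (\<Prod>r<l. \<integral>s. std_normal_density s * s ^ ?k r \<partial>lborel)"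
    using gauss_product_moment(2)[of l ?k] unfolding eq .
  also have "\<dots> = (if i = j then 1 else 0)"
  proof (cases "i = j")
    case True
    then show ?thesis using m by (intro trans[OF prod.neutral]) (auto simp: numeral_2_eq_2)
  next
    case False
    then show ?thesis using m i by (auto intro!: prod_zero bexI[of _ i])
  qed
  finally show "(\<integral>x. x $ i * x $ j \<partial>gauss l) = (if i = j then 1 else 0)" .
qed

section \<open>Directions in which a function is constant\<close>

text \<open>
  Uniformly in small \<open>t\<close>, the difference quotient that tends to \<open>y\<close> is dominated by an
  exponential function; this is the majorant for the limit in \<open>gauss_orthogonal_invariant_direction\<close>.
\<close>

lemma abs_exp_diff_le:
  fixes t y :: real
  assumes t: "0 < t" "t \<le> 1"
  shows "\<bar>(exp (t * y) - exp (- t * y)) / (2 * t)\<bar> \<le> exp (2 * y) + exp (- 2 * y)"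
proof -
  have *: "\<bar>exp s - exp (- s)\<bar> \<le> 2 * s * exp s" if "0 \<le> s" for s :: real
  proof -
    have "1 + (- 2 * s) \<le> exp (- 2 * s)" by (rule exp_ge_add_one_self)
    then have "exp s * (1 - 2 * s) \<le> exp s * exp (- 2 * s)" by (intro mult_left_mono) auto
    also have "\<dots> = exp (- s)" by (simp add: mult_exp_exp)
    finally show ?thesis using that by (simp add: algebra_simps abs_if)
  qed
  have "\<bar>exp (t * y) - exp (- t * y)\<bar> \<le> 2 * (t * \<bar>y\<bar>) * exp (t * \<bar>y\<bar>)"
  proof (cases "0 \<le> y")
    case True
    then show ?thesis using *[of "t * y"] t by simp
  next
    case False
    then show ?thesis using *[of "t * - y"] t mult_nonneg_nonpos[of t y] by (simp add: abs_minus_commute)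
  qed
  then have "\<bar>(exp (t * y) - exp (- t * y)) / (2 * t)\<bar> \<le> \<bar>y\<bar> * exp (t * \<bar>y\<bar>)"
    using t by (simp add: abs_mult field_simps)
  also have "\<dots> \<le> exp \<bar>y\<bar> * exp \<bar>y\<bar>"
  proof (intro mult_mono)
    show "\<bar>y\<bar> \<le> exp \<bar>y\<bar>" using exp_ge_add_one_self[of "\<bar>y\<bar>"] by linarith
    show "exp (t * \<bar>y\<bar>) \<le> exp \<bar>y\<bar>" using t by (simp add: mult_left_le_one_le)
  qed auto
  also have "\<dots> = exp (2 * \<bar>y\<bar>)" by (simp add: mult_exp_exp)
  also have "\<dots> \<le> exp (2 * y) + exp (- 2 * y)" by (cases "0 \<le> y") auto
  finally show ?thesis .
qed

lemma gauss_integral_translate: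
  fixes g :: "real vec \<Rightarrow> real"
  assumes a: "a \<in> carrier_vec l" and g [measurable]: "g \<in> borel_measurable (vec_borel l)"
  shows "(\<integral>x. g (x + a) \<partial>gauss l) = (\<integral>x. exp (a \<bullet> x - a \<bullet> a / 2) * g x \<partial>gauss l)"
    and "integrable (gauss l) (\<lambda>x. g (x + a))
      \<longleftrightarrow> integrable (gauss l) (\<lambda>x. exp (a \<bullet> x - a \<bullet> a / 2) * g x)"
proof -
  note [measurable] = measurable_add_vec[OF a] measurable_scalar_prod[OF a]
  have T: "(\<lambda>x. x + a) \<in> measurable (gauss l) (vec_borel l)" by measurable
  show "(\<integral>x. g (x + a) \<partial>gauss l) = (\<integral>x. exp (a \<bullet> x - a \<bullet> a / 2) * g x \<partial>gauss l)"
    using integral_distr[OF T g] unfolding gauss_translate[OF a]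
    by (subst (asm) integral_density) auto
  show "integrable (gauss l) (\<lambda>x. g (x + a))
      \<longleftrightarrow> integrable (gauss l) (\<lambda>x. exp (a \<bullet> x - a \<bullet> a / 2) * g x)"
    using integrable_distr_eq[OF T g] unfolding gauss_translate[OF a]
    by (subst (asm) integrable_density) auto
qed

text \<open>
  The shift of the constant function 1 is integrable, and the Cameron-Martin formula turns it into an
  exponential.
\<close>

lemma gauss_integrable_exp:
  assumes a: "a \<in> carrier_vec l"
  shows "integrable (gauss l) (\<lambda>x. exp (a \<bullet> x))"
proof -
  interpret prob_space "gauss l" by (rule prob_space_gauss)
  have "integrable (gauss l) (\<lambda>x. exp (a \<bullet> x - a \<bullet> a / 2) * 1)"
    using gauss_integral_translate(2)[OF a, of "\<lambda>_. 1"] by simp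
  then have "integrable (gauss l) (\<lambda>x. exp (a \<bullet> a / 2) * (exp (a \<bullet> x - a \<bullet> a / 2) * 1))"
    by (rule integrable_mult_right)
  then show ?thesis by (simp add: mult_exp_exp)
qed

lemma integrable_mult_of_squares:
  fixes f g :: "'a \<Rightarrow> real"
  assumes [measurable]: "f \<in> borel_measurable M" "g \<in> borel_measurable M"
    and f: "integrable M (\<lambda>x. (f x)\<^sup>2)" and g: "integrable M (\<lambda>x. (g x)\<^sup>2)"
  shows "integrable M (\<lambda>x. f x * g x)"
proof (rule Bochner_Integration.integrable_bound)
  show "integrable M (\<lambda>x. (f x)\<^sup>2 + (g x)\<^sup>2)" using f g by simp
  have "\<bar>s * t\<bar> \<le> s\<^sup>2 + t\<^sup>2" for s t :: real
  proof -
    have "2 * (\<bar>s\<bar> * \<bar>t\<bar>) \<le> s\<^sup>2 + t\<^sup>2"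
      using sum_squares_bound[of "\<bar>s\<bar>" "\<bar>t\<bar>"] by simp
    moreover have "0 \<le> \<bar>s\<bar> * \<bar>t\<bar>" by simp
    ultimately show ?thesis unfolding abs_mult by linarith
  qed
  then show "AE x in M. norm (f x * g x) \<le> norm ((f x)\<^sup>2 + (g x)\<^sup>2)"
    by (auto intro!: AE_I2)
qed measurable

text \<open>
  For \<open>Y = v \<bullet> \<zeta>\<close> this says that \<open>u(\<zeta>)\<close> and \<open>Y\<close> are uncorrelated when \<open>u\<close> does not vary in the direction
  \<open>v\<close>. Since \<open>u\<close> is unchanged by the shift \<open>t v\<close>, Cameron-Martin gives
  \<open>E[u e\<^bsup>t Y\<^esup>] = e\<^bsup>t\<^sup>2 |v|\<^sup>2 / 2\<^esup> E[u]\<close>. The right side is even in \<open>t\<close>, so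
  \<open>E[u (e\<^bsup>t Y\<^esup> - e\<^bsup>- t Y\<^esup>) / (2 t)] = 0\<close>, and \<open>t \<rightarrow> 0\<close> gives \<open>E[u Y] = 0\<close>.
\<close>

lemma gauss_orthogonal_invariant_direction:
  fixes u :: "real vec \<Rightarrow> real"
  assumes v: "v \<in> carrier_vec l"
    and u [measurable]: "u \<in> borel_measurable (vec_borel l)"
    and u2: "integrable (gauss l) (\<lambda>x. (u x)\<^sup>2)"
    and inv: "\<And>x t. x \<in> carrier_vec l \<Longrightarrow> u (x + t \<cdot>\<^sub>v v) = u x"
  shows "(\<integral>x. u x * (v \<bullet> x) \<partial>gauss l) = 0"
proof -
  note [measurable] = measurable_scalar_prod[OF v]
  have av: "t \<cdot>\<^sub>v v \<in> carrier_vec l" for t :: real using v by simp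
  have tv: "(t \<cdot>\<^sub>v v) \<bullet> x = t * (v \<bullet> x)" if "x \<in> carrier_vec l" for t :: real and x
    using v that by simp
  have iexp: "integrable (gauss l) (\<lambda>x. exp (t * (v \<bullet> x)))" for t
    using gauss_integrable_exp[OF av[of t]]
    by (rule Bochner_Integration.integrable_cong[THEN iffD1, rotated 2]) (auto simp: tv)
  have iexp2: "integrable (gauss l) (\<lambda>x. (exp (t * (v \<bullet> x)))\<^sup>2)" for t
    using iexp[of "2 * t"] by (simp add: exp_double mult.assoc)
  have iu: "integrable (gauss l) (\<lambda>x. u x * exp (t * (v \<bullet> x)))" for t
    by (rule integrable_mult_of_squares[OF _ _ u2 iexp2]) measurable
  define c where "c = v \<bullet> v"
  have key: "(\<integral>x. u x * exp (t * (v \<bullet> x)) \<partial>gauss l) = exp (t\<^sup>2 * c / 2) * (\<integral>x. u x \<partial>gauss l)" for t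
  proof -
    have "(\<integral>x. u x \<partial>gauss l) = (\<integral>x. u (x + t \<cdot>\<^sub>v v) \<partial>gauss l)"
      by (rule Bochner_Integration.integral_cong) (auto simp: inv)
    also have "\<dots> = (\<integral>x. exp ((t \<cdot>\<^sub>v v) \<bullet> x - (t \<cdot>\<^sub>v v) \<bullet> (t \<cdot>\<^sub>v v) / 2) * u x \<partial>gauss l)"
      by (rule gauss_integral_translate(1)[OF av u])
    also have "\<dots> = (\<integral>x. exp (- (t\<^sup>2 * c / 2)) * (u x * exp (t * (v \<bullet> x))) \<partial>gauss l)"
    proof (rule Bochner_Integration.integral_cong)
      fix x assume "x \<in> space (gauss l)"
      then have x: "x \<in> carrier_vec l" by simp
      have "(t \<cdot>\<^sub>v v) \<bullet> (t \<cdot>\<^sub>v v) = t\<^sup>2 * c"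
        using v by (simp add: c_def power2_eq_square)
      then show "exp ((t \<cdot>\<^sub>v v) \<bullet> x - (t \<cdot>\<^sub>v v) \<bullet> (t \<cdot>\<^sub>v v) / 2) * u x
          = exp (- (t\<^sup>2 * c / 2)) * (u x * exp (t * (v \<bullet> x)))"
        by (simp add: tv[OF x] mult_exp_exp)
    qed simp
    also have "\<dots> = exp (- (t\<^sup>2 * c / 2)) * (\<integral>x. u x * exp (t * (v \<bullet> x)) \<partial>gauss l)"
      by simp
    finally show ?thesis by (simp add: mult_exp_exp flip: mult.assoc)
  qed
  \<comment> \<open>the difference quotient at \<open>t = 1 / (k + 1)\<close>\<close>
  let ?s = "\<lambda>k x. u x * ((exp (inverse (real (Suc k)) * (v \<bullet> x))
      - exp (- inverse (real (Suc k)) * (v \<bullet> x))) / (2 * inverse (real (Suc k))))"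
  have zero: "(\<integral>x. ?s k x \<partial>gauss l) = 0" for k
  proof -
    let ?t = "inverse (real (Suc k))"
    have "(\<integral>x. ?s k x \<partial>gauss l) = (\<integral>x. (1 / (2 * ?t)) * (u x * exp (?t * (v \<bullet> x))
        - u x * exp (- ?t * (v \<bullet> x))) \<partial>gauss l)"
      by (rule Bochner_Integration.integral_cong) (auto simp: field_simps)
    also have "\<dots> = (1 / (2 * ?t)) * ((\<integral>x. u x * exp (?t * (v \<bullet> x)) \<partial>gauss l)
        - (\<integral>x. u x * exp (- ?t * (v \<bullet> x)) \<partial>gauss l))"
      unfolding integral_mult_right_zero
      by (subst Bochner_Integration.integral_diff[OF iu iu]) simp
    also have "\<dots> = 0" unfolding key by simp
    finally show ?thesis .
  qed
  let ?w = "\<lambda>x. \<bar>u x\<bar> * (exp (2 * (v \<bullet> x)) + exp (- 2 * (v \<bullet> x)))"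
  have "(\<lambda>k. \<integral>x. ?s k x \<partial>gauss l) \<longlonglongrightarrow> (\<integral>x. u x * (v \<bullet> x) \<partial>gauss l)"
  proof (rule integral_dominated_convergence[where w = ?w])
    show "integrable (gauss l) ?w"
    proof -
      have "integrable (gauss l) (\<lambda>x. \<bar>u x * exp (2 * (v \<bullet> x))\<bar> + \<bar>u x * exp (- 2 * (v \<bullet> x))\<bar>)"
        using iu by (intro Bochner_Integration.integrable_add integrable_abs)
      then show ?thesis by (simp add: abs_mult distrib_left)
    qed
    show "AE x in gauss l. (\<lambda>k. ?s k x) \<longlonglongrightarrow> u x * (v \<bullet> x)"
    proof (rule AE_I2)
      fix x
      let ?y = "v \<bullet> x"
      have "((\<lambda>t. exp (t * ?y) - exp (- t * ?y)) has_real_derivative 2 * ?y) (at 0)"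
        by (auto intro!: derivative_eq_intros)
      then have "((\<lambda>t. (exp (t * ?y) - exp (- t * ?y)) / t) \<longlongrightarrow> 2 * ?y) (at 0)"
        by (simp add: has_field_derivative_iff)
      moreover have "filterlim (\<lambda>k. inverse (real (Suc k))) (at 0) sequentially"
        using LIMSEQ_inverse_real_of_nat by (simp add: filterlim_at)
      ultimately have "(\<lambda>k. (exp (inverse (real (Suc k)) * ?y) - exp (- inverse (real (Suc k)) * ?y))
          / inverse (real (Suc k))) \<longlonglongrightarrow> 2 * ?y"
        by (rule filterlim_compose)
      then have "(\<lambda>k. u x * (1/2 * ((exp (inverse (real (Suc k)) * ?y) - exp (- inverse (real (Suc k)) * ?y))
          / inverse (real (Suc k))))) \<longlonglongrightarrow> u x * (1/2 * (2 * ?y))"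
        by (intro tendsto_mult_left)
      then show "(\<lambda>k. ?s k x) \<longlonglongrightarrow> u x * ?y" by simp
    qed
    show "AE x in gauss l. norm (?s k x) \<le> ?w x" for k
    proof (rule AE_I2)
      fix x
      have t: "0 < inverse (real (Suc k))" "inverse (real (Suc k)) \<le> 1"
        by (auto simp: field_simps)
      show "norm (?s k x) \<le> ?w x"
        unfolding real_norm_def abs_mult[of "u x"]
        by (rule mult_left_mono[OF abs_exp_diff_le[OF t]]) simp
    qed
  qed measurable
  then show ?thesis
    unfolding zero by (simp add: LIMSEQ_const_iff)
qed

text \<open>
  Gram-Schmidt, by induction on the number \<open>p\<close> of vectors: the residual of \<open>a\<close> with respect to the first
  \<open>p\<close> vectors is corrected along the residual of the next one. The vectors \<open>w r\<close> may be
  linearly dependent; a vanishing residual makes the coefficient \<open>c\<close> equal to \<open>0 / 0 = 0\<close>.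
\<close>

lemma orthogonal_decomposition:
  fixes w :: "nat \<Rightarrow> nat \<Rightarrow> real" and a :: "nat \<Rightarrow> real"
  shows "\<exists>k. \<forall>j<p. (\<Sum>i<l. (a i - (\<Sum>r<p. k r * w r i)) * w j i) = 0"
proof (induction p arbitrary: a)
  case 0 then show ?case by simp
next
  case (Suc p)
  obtain k where k: "\<And>j. j < p \<Longrightarrow> (\<Sum>i<l. (a i - (\<Sum>r<p. k r * w r i)) * w j i) = 0"
    using Suc[of a] by blast
  obtain h where h: "\<And>j. j < p \<Longrightarrow> (\<Sum>i<l. (w p i - (\<Sum>r<p. h r * w r i)) * w j i) = 0"
    using Suc[of "w p"] by blast
  define a' where "a' i = a i - (\<Sum>r<p. k r * w r i)" for i
  define w' where "w' i = w p i - (\<Sum>r<p. h r * w r i)" for i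
  define c where "c = (\<Sum>i<l. a' i * w' i) / (\<Sum>i<l. w' i * w' i)"
  have ka: "(\<Sum>i<l. a' i * w j i) = 0" if "j < p" for j
    using k[OF that] by (simp add: a'_def)
  have hw: "(\<Sum>i<l. w' i * w j i) = 0" if "j < p" for j
    using h[OF that] by (simp add: w'_def)
  have c: "(\<Sum>i<l. a' i * w' i) = c * (\<Sum>i<l. w' i * w' i)"
  proof (cases "(\<Sum>i<l. w' i * w' i) = 0")
    case True
    then have "\<forall>i<l. w' i = 0" by (auto simp: sum_nonneg_eq_0_iff)
    then show ?thesis by simp
  qed (simp add: c_def)
  have wp: "(\<Sum>i<l. f i * w p i) = (\<Sum>i<l. f i * w' i) + (\<Sum>r<p. h r * (\<Sum>i<l. f i * w r i))" for f
  proof -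
    have "(\<Sum>r<p. h r * (\<Sum>i<l. f i * w r i)) = (\<Sum>i<l. f i * (\<Sum>r<p. h r * w r i))"
      unfolding sum_distrib_left by (subst sum.swap) (simp add: mult_ac)
    then show ?thesis
      by (simp add: w'_def algebra_simps sum_subtractf)
  qed
  define kk where "kk r = (if r = p then c else k r - c * h r)" for r
  have res: "a i - (\<Sum>r<Suc p. kk r * w r i) = a' i - c * w' i" for i
    by (simp add: kk_def a'_def w'_def sum_subtractf algebra_simps sum_distrib_left)
  have lo: "(\<Sum>i<l. (a' i - c * w' i) * w j i) = 0" if "j < p" for j
    using ka[OF that] hw[OF that]
    by (simp add: left_diff_distrib sum_subtractf mult.assoc flip: sum_distrib_left)
  have "(\<Sum>i<l. (a' i - c * w' i) * w p i) = 0"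
    unfolding wp using c
    by (simp add: lo) (simp add: left_diff_distrib sum_subtractf mult.assoc flip: sum_distrib_left)
  with lo show ?case
    unfolding res[symmetric] by (intro exI[of _ kk]) (auto simp: less_Suc_eq)
qed

section \<open>The loss as a quadratic form\<close>

definition qform :: "nat \<Rightarrow> real mat \<Rightarrow> (nat \<Rightarrow> real) \<Rightarrow> real" where
  "qform m Q y = (\<Sum>r<m. \<Sum>s<m. Q $$ (r, s) * (y r * y s))"

lemma qform_eq_scalar_prod:
  assumes "Q \<in> carrier_mat m m"
  shows "qform m Q y = vec m y \<bullet> (Q *\<^sub>v vec m y)"
proof -
  have "vec m y \<bullet> (Q *\<^sub>v vec m y) = (\<Sum>r<m. vec m y $ r * (Q *\<^sub>v vec m y) $ r)"
    using assms by (auto simp: scalar_prod_def lessThan_atLeast0)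
  also have "\<dots> = qform m Q y"
    unfolding qform_def
    by (intro sum.cong refl)
      (simp add: mult_mat_vec_index[OF assms] sum_distrib_left mult_ac del: index_mult_mat_vec)
  finally show ?thesis by simp
qed

lemma qform_nonneg:
  assumes "sym_pos_def m Q"
  shows "0 \<le> qform m Q y"
proof -
  have Q: "Q \<in> carrier_mat m m" using assms by (simp add: sym_pos_def_def)
  show ?thesis
  proof (cases "vec m y = 0\<^sub>v m")
    case True
    then show ?thesis using Q by (simp add: qform_eq_scalar_prod)
  next
    case False
    then have "0 < vec m y \<bullet> (Q *\<^sub>v vec m y)"
      using assms by (auto simp: sym_pos_def_def)
    then show ?thesis using Q by (simp add: qform_eq_scalar_prod)
  qed
qed

text \<open>
  Let \<open>e\<close> be column \<open>r\<close> of \<open>Q\<^sup>-\<^sup>1\<close>. Then \<open>y r\<close> is the \<open>Q\<close>-inner product of \<open>y\<close> and \<open>e\<close>, so this is the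
  Cauchy-Schwarz inequality for \<open>Q\<close>, with \<open>c\<close> the squared \<open>Q\<close>-norm of \<open>e\<close>. It is what makes policies
  of finite cost square integrable.
\<close>

lemma qform_coercive:
  assumes Q: "sym_pos_def m Q" and r: "r < m"
  obtains c where "0 \<le> c" and "\<And>y. (y r)\<^sup>2 \<le> c * qform m Q y"
proof -
  obtain P where P: "P \<in> carrier_mat m m" "Q * P = 1\<^sub>m m"
    using sym_pos_def_inverse[OF Q] by blast
  have Qc: "Q \<in> carrier_mat m m" and Qs: "Q\<^sup>T = Q" using Q by (auto simp: sym_pos_def_def)
  define e where "e = P *\<^sub>v unit_vec m r"
  have e: "e \<in> carrier_vec m" using P by (simp add: e_def)
  have Qe: "Q *\<^sub>v e = unit_vec m r"
    using assoc_mult_mat_vec[OF Qc P(1), of "unit_vec m r"] P(2) by (simp add: e_def)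
  define c where "c = e \<bullet> (Q *\<^sub>v e)"
  have "e \<noteq> 0\<^sub>v m"
  proof
    assume "e = 0\<^sub>v m"
    moreover have "Q *\<^sub>v 0\<^sub>v m = 0\<^sub>v m" using Qc by (intro eq_vecI) auto
    ultimately have "unit_vec m r = (0\<^sub>v m :: real vec)" using Qe by simp
    then have "unit_vec m r $ r = (0\<^sub>v m :: real vec) $ r" by simp
    then show False using r by simp
  qed
  then have c: "0 < c" using Q e by (auto simp: c_def sym_pos_def_def)
  have "(y r)\<^sup>2 \<le> c * qform m Q y" for y
  proof -
    define u where "u = vec m y"
    \<comment> \<open>minimizes \<open>qform m Q (y + t e)\<close> over \<open>t\<close>\<close>
    define t where "t = - (y r / c)"
    have u: "u \<in> carrier_vec m" by (simp add: u_def)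
    have te: "t \<cdot>\<^sub>v e \<in> carrier_vec m" using e by simp
    have eu: "e \<bullet> (Q *\<^sub>v u) = y r"
      using transpose_vec_mult_scalar[of Q m m u e] Qc Qs u e Qe r
      by (simp add: u_def)
    have ue: "u \<bullet> (Q *\<^sub>v e) = y r" using r u by (simp add: Qe) (simp add: u_def)
    have "vec m (\<lambda>i. (u + t \<cdot>\<^sub>v e) $ i) = u + t \<cdot>\<^sub>v e"
      using u te by (intro eq_vecI) auto
    then have "0 \<le> (u + t \<cdot>\<^sub>v e) \<bullet> (Q *\<^sub>v (u + t \<cdot>\<^sub>v e))"
      using qform_nonneg[OF Q, of "\<lambda>i. (u + t \<cdot>\<^sub>v e) $ i"] by (simp only: qform_eq_scalar_prod[OF Qc])
    also have "\<dots> = u \<bullet> (Q *\<^sub>v u) + 2 * (t * y r) + t * (t * c)"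
      using Qc u e te
      by (simp add: mult_add_distrib_mat_vec[OF Qc u te] add_scalar_prod_distrib[OF u te]
          scalar_prod_add_distrib[of _ m] mult_mat_vec[OF Qc e] eu ue c_def)
        (simp add: algebra_simps)
    also have "\<dots> = qform m Q y - (y r)\<^sup>2 / c"
      using c Qc by (simp add: t_def qform_eq_scalar_prod u_def field_simps power2_eq_square)
    finally show ?thesis using c by (simp add: field_simps)
  qed
  with c that show thesis by (meson less_imp_le)
qed

lemma team_loss_eq_square:
  assumes Q: "sym_pos_def m Q" and S: "S \<in> carrier_mat m k"
    and u: "u \<in> carrier_vec m" and x: "x \<in> carrier_vec k"
  shows "team_loss Q S u x = 1/2 * qform m Q (\<lambda>r. u $ r + (the (mat_inverse Q) *\<^sub>v (S *\<^sub>v x)) $ r)"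
proof -
  obtain P where P: "mat_inverse Q = Some P" "P \<in> carrier_mat m m" "Q * P = 1\<^sub>m m"
    using sym_pos_def_inverse[OF Q] by blast
  have Qc: "Q \<in> carrier_mat m m" and Qs: "Q\<^sup>T = Q" using Q by (auto simp: sym_pos_def_def)
  define y where "y = S *\<^sub>v x"
  define z where "z = P *\<^sub>v y"
  have y: "y \<in> carrier_vec m" using S x by (simp add: y_def)
  have z: "z \<in> carrier_vec m" using P(2) y by (simp add: z_def)
  have Qz: "Q *\<^sub>v z = y"
    using assoc_mult_mat_vec[OF Qc P(2) y] P(3) y by (simp add: z_def)
  have "(S\<^sup>T * P * S) *\<^sub>v x = S\<^sup>T *\<^sub>v z"
  proof -
    have "S\<^sup>T * P \<in> carrier_mat k m" using S P(2) by simp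
    then show ?thesis
      using assoc_mult_mat_vec[of "S\<^sup>T * P" k m S k x] assoc_mult_mat_vec[of "S\<^sup>T" k m P m y] S P(2) x y
      by (simp add: z_def y_def)
  qed
  then have quad: "x \<bullet> ((S\<^sup>T * the (mat_inverse Q) * S) *\<^sub>v x) = y \<bullet> z"
    using transpose_vec_mult_scalar[of "S\<^sup>T" k m z x] S x z
    by (simp add: P(1) y_def)
  have zQu: "z \<bullet> (Q *\<^sub>v u) = u \<bullet> y"
    using transpose_vec_mult_scalar[of Q m m u z] Qc Qs Qz u z y
    by (simp add: comm_scalar_prod[OF y u])
  have "(u + z) \<bullet> (Q *\<^sub>v (u + z)) = u \<bullet> (Q *\<^sub>v u) + 2 * (u \<bullet> y) + y \<bullet> z"
    using Qc u z y zQu Qz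
    by (simp add: mult_add_distrib_mat_vec[OF Qc u z] add_scalar_prod_distrib[OF u z]
        scalar_prod_add_distrib[of _ m] comm_scalar_prod[OF z y])
  moreover have "vec m (\<lambda>r. u $ r + z $ r) = u + z"
    using u z by auto
  ultimately show ?thesis
    unfolding team_loss_def quad unfolding P(1) y_def[symmetric]
    by (simp add: qform_eq_scalar_prod[OF Qc] flip: z_def)
qed

text \<open>
  Component \<open>r\<close> of \<open>u + Q\<^sup>-\<^sup>1 S \<xi>\<close>, written as a function of \<open>y = R\<^sup>T \<xi>\<close>, through which alone both the
  observations \<open>H\<^sub>i \<xi> = W\<^sub>i y\<close> and the environment \<open>S \<xi> = W\<^sub>0 y\<close> depend on \<open>\<xi>\<close> and \<open>R\<close>.
\<close>

definition shifted_action :: "nat \<Rightarrow> (nat \<Rightarrow> nat) \<Rightarrow> real mat \<Rightarrow> real mat \<Rightarrow>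
    (nat \<Rightarrow> real vec \<Rightarrow> real) \<Rightarrow> real vec \<Rightarrow> nat \<Rightarrow> real" where
  "shifted_action m ls Q W \<gamma> y r =
     \<gamma> r (W_obs m ls W r *\<^sub>v y) + ((the (mat_inverse Q) * W_env m ls W) *\<^sub>v y) $ r"

lemma W_carrier [simp]:
  "W_env m ls W \<in> carrier_mat m (total_dim m ls)"
  "W_obs m ls W i \<in> carrier_mat (ls i) (total_dim m ls)"
  by (simp_all add: W_env_def W_obs_def)

lemma policy_loss_eq_qform:
  assumes Q: "sym_pos_def m Q" and R: "R \<in> carrier_mat k (total_dim m ls)" and x: "x \<in> carrier_vec k"
  shows "policy_loss m ls Q W R \<gamma> x = 1/2 * qform m Q (shifted_action m ls Q W \<gamma> (R\<^sup>T *\<^sub>v x))"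
proof -
  obtain P where P: "mat_inverse Q = Some P" "P \<in> carrier_mat m m"
    using sym_pos_def_inverse[OF Q] by blast
  have RT: "R\<^sup>T \<in> carrier_mat (total_dim m ls) k" using R by simp
  have S: "S_mat m ls W R \<in> carrier_mat m k"
    unfolding S_mat_def using RT W_carrier(1) by (rule mult_carrier_mat[rotated])
  have Sx: "S_mat m ls W R *\<^sub>v x = W_env m ls W *\<^sub>v (R\<^sup>T *\<^sub>v x)"
    unfolding S_mat_def by (rule assoc_mult_mat_vec[OF W_carrier(1) RT x])
  have Hx: "H_mat m ls W R i *\<^sub>v x = W_obs m ls W i *\<^sub>v (R\<^sup>T *\<^sub>v x)" for i
    unfolding H_mat_def by (rule assoc_mult_mat_vec[OF W_carrier(2) RT x])
  have Px: "P *\<^sub>v (W_env m ls W *\<^sub>v (R\<^sup>T *\<^sub>v x)) = (P * W_env m ls W) *\<^sub>v (R\<^sup>T *\<^sub>v x)"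
    using RT x by (intro assoc_mult_mat_vec[OF P(2) W_carrier(1), symmetric]) auto
  show ?thesis
    unfolding policy_loss_def
    by (subst team_loss_eq_square[OF Q S _ x], simp)
       (simp add: Sx Hx P(1) Px qform_def shifted_action_def del: index_mult_mat_vec)
qed

lemma measurable_shifted_action:
  assumes Q: "sym_pos_def m Q" and \<gamma>: "\<gamma> \<in> policies m ls" and r: "r < m"
  shows "(\<lambda>y. shifted_action m ls Q W \<gamma> y r) \<in> borel_measurable (vec_borel (total_dim m ls))"
proof -
  obtain P where P: "mat_inverse Q = Some P" "P \<in> carrier_mat m m"
    using sym_pos_def_inverse[OF Q] by blast
  have PW: "P * W_env m ls W \<in> carrier_mat m (total_dim m ls)"
    using P(2) W_carrier(1) by (rule mult_carrier_mat)
  have \<gamma>r: "\<gamma> r \<in> borel_measurable (vec_borel (ls r))"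
    using \<gamma> r by (simp add: policies_def)
  have "(\<lambda>y. W_obs m ls W r *\<^sub>v y) \<in> measurable (vec_borel (total_dim m ls)) (vec_borel (ls r))"
    by (rule measurable_mult_mat_vec[OF W_carrier(2)]) simp
  from measurable_compose[OF this \<gamma>r]
  have "(\<lambda>y. \<gamma> r (W_obs m ls W r *\<^sub>v y)) \<in> borel_measurable (vec_borel (total_dim m ls))" .
  moreover have "(\<lambda>y. ((P * W_env m ls W) *\<^sub>v y) $ r) \<in> borel_measurable (vec_borel (total_dim m ls))"
    by (rule measurable_vec_index[OF measurable_mult_mat_vec[OF PW] r]) simp
  ultimately show ?thesis
    unfolding shifted_action_def P(1) option.sel by (rule borel_measurable_add)
qed

definition square_loss :: "nat \<Rightarrow> (nat \<Rightarrow> nat) \<Rightarrow> real mat \<Rightarrow> real mat \<Rightarrow>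
    (nat \<Rightarrow> real vec \<Rightarrow> real) \<Rightarrow> real vec \<Rightarrow> real" where
  "square_loss m ls Q W \<gamma> y = 1/2 * qform m Q (shifted_action m ls Q W \<gamma> y)"

lemma measurable_square_loss:
  assumes "sym_pos_def m Q" and "\<gamma> \<in> policies m ls"
  shows "square_loss m ls Q W \<gamma> \<in> borel_measurable (vec_borel (total_dim m ls))"
  unfolding square_loss_def[abs_def] qform_def
  by (intro borel_measurable_times borel_measurable_const borel_measurable_sum
      measurable_shifted_action assms) auto

lemma square_loss_nonneg: "sym_pos_def m Q \<Longrightarrow> 0 \<le> square_loss m ls Q W \<gamma> y"
  by (simp add: square_loss_def qform_nonneg)

text \<open>
  All problems of the ensemble and the Gaussian problem minimize the same functional of the policy;
  they differ only in the law of \<open>R\<^sup>T \<xi>\<close> with respect to which it is integrated.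
\<close>

lemma team_cost_eq_law:
  assumes Q: "sym_pos_def m Q" and \<gamma>: "\<gamma> \<in> policies m ls"
    and R: "R \<in> carrier_mat k (total_dim m ls)" and X: "X \<in> measurable M (vec_borel k)"
  shows "team_cost m ls Q W R M X \<gamma> = enn2ereal (\<integral>\<^sup>+ y. ennreal (square_loss m ls Q W \<gamma> y)
    \<partial>distr M (vec_borel (total_dim m ls)) (\<lambda>\<omega>. R\<^sup>T *\<^sub>v X \<omega>))"
proof -
  have "R\<^sup>T \<in> carrier_mat (total_dim m ls) k" using R by simp
  note [measurable] = measurable_square_loss[OF Q \<gamma>, of W] measurable_mult_mat_vec[OF this X]
  have "(\<integral>\<^sup>+ \<omega>. ennreal (policy_loss m ls Q W R \<gamma> (X \<omega>)) \<partial>M)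
      = (\<integral>\<^sup>+ \<omega>. ennreal (square_loss m ls Q W \<gamma> (R\<^sup>T *\<^sub>v X \<omega>)) \<partial>M)"
    using measurable_space[OF X]
    by (intro nn_integral_cong) (simp add: policy_loss_eq_qform[OF Q R] square_loss_def)
  also have "\<dots> = (\<integral>\<^sup>+ y. ennreal (square_loss m ls Q W \<gamma> y)
      \<partial>distr M (vec_borel (total_dim m ls)) (\<lambda>\<omega>. R\<^sup>T *\<^sub>v X \<omega>))"
    by (rule nn_integral_distr[symmetric]) measurable
  finally show ?thesis by (simp add: team_cost_def)
qed

lemma distr_one_mult_vec:
  assumes Z: "Z \<in> measurable N (vec_borel l)"
  shows "distr N (vec_borel l) (\<lambda>\<omega>. (1\<^sub>m l)\<^sup>T *\<^sub>v Z \<omega>) = distr N (vec_borel l) Z"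
  using measurable_space[OF Z] by (intro distr_cong) auto

lemma gauss_cost_eq:
  assumes Q: "sym_pos_def m Q" and \<gamma>: "\<gamma> \<in> policies m ls"
    and Z: "Z \<in> measurable N (vec_borel (total_dim m ls))"
    and law: "distr N (vec_borel (total_dim m ls)) Z = gauss (total_dim m ls)"
  shows "gauss_cost m ls Q W N Z \<gamma>
    = enn2ereal (\<integral>\<^sup>+ y. ennreal (square_loss m ls Q W \<gamma> y) \<partial>gauss (total_dim m ls))"
  unfolding team_cost_eq_law[OF Q \<gamma> one_carrier_mat Z] distr_one_mult_vec[OF Z] law ..

lemma gauss_cost_on_eq:
  assumes Q: "sym_pos_def m Q" and \<gamma>: "\<gamma> \<in> policies m ls"
    and Z: "Z \<in> measurable N (vec_borel (total_dim m ls))"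
    and law: "distr N (vec_borel (total_dim m ls)) Z = gauss (total_dim m ls)"
    and A: "A \<in> sets (vec_borel (total_dim m ls))"
  shows "gauss_cost_on m ls Q W A N Z \<gamma>
    = enn2ereal (\<integral>\<^sup>+ y. ennreal (indicator A y * square_loss m ls Q W \<gamma> y) \<partial>gauss (total_dim m ls))"
proof -
  note [measurable] = measurable_square_loss[OF Q \<gamma>, of W] A Z
  have "(\<integral>\<^sup>+ \<omega>. ennreal (indicator A (Z \<omega>) * policy_loss m ls Q W (1\<^sub>m (total_dim m ls)) \<gamma> (Z \<omega>)) \<partial>N)
      = (\<integral>\<^sup>+ \<omega>. ennreal (indicator A (Z \<omega>) * square_loss m ls Q W \<gamma> (Z \<omega>)) \<partial>N)"
    using measurable_space[OF Z]
    by (intro nn_integral_cong)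
      (simp add: policy_loss_eq_qform[OF Q one_carrier_mat] square_loss_def)
  also have "\<dots> = (\<integral>\<^sup>+ y. ennreal (indicator A y * square_loss m ls Q W \<gamma> y)
      \<partial>distr N (vec_borel (total_dim m ls)) Z)"
    by (rule nn_integral_distr[symmetric]) measurable
  finally show ?thesis by (simp add: gauss_cost_on_def law)
qed

section \<open>Linear policies are optimal in the Gaussian problem\<close>

definition linear_policy :: "(nat \<Rightarrow> nat) \<Rightarrow> (nat \<Rightarrow> nat \<Rightarrow> real) \<Rightarrow> nat \<Rightarrow> real vec \<Rightarrow> real" where
  "linear_policy ls K i y = (\<Sum>j<ls i. K i j * y $ j)"

lemma linear_policy_in_policies: "linear_policy ls K \<in> policies m ls"
  unfolding policies_def linear_policy_def
  by (auto intro!: borel_measurable_sum borel_measurable_times measurable_vec_nth)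

text \<open>
  The projection of a function of the observation \<open>A \<zeta>\<close> onto the linear functions of \<open>\<zeta>\<close> is again a
  function of \<open>A \<zeta>\<close>. Its coefficient vector is \<open>a\<close>; split off the part \<open>v\<close> of \<open>a\<close> orthogonal to the rows of \<open>A\<close>.
  Then \<open>A v = 0\<close>, so \<open>g(A \<zeta>)\<close> does not vary along \<open>v\<close>, hence \<open>v \<bullet> a = E[g(A \<zeta>) (v \<bullet> \<zeta>)] = 0\<close>,
  which forces \<open>v = 0\<close>: \<open>a\<close> is a combination of the rows.
\<close>

lemma gauss_observation_projection:
  fixes g :: "real vec \<Rightarrow> real"
  assumes A: "A \<in> carrier_mat p l"
    and g: "g \<in> borel_measurable (vec_borel p)"
    and g2: "integrable (gauss l) (\<lambda>x. (g (A *\<^sub>v x))\<^sup>2)"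
  shows "\<exists>k. \<forall>x::real vec\<in>carrier_vec l.
    (\<Sum>j<p. k j * (A *\<^sub>v x) $ j) = (\<Sum>i<l. (\<integral>x. g (A *\<^sub>v x) * x $ i \<partial>gauss l) * x $ i)"
proof -
  define a where "a i = (\<integral>x. g (A *\<^sub>v x) * x $ i \<partial>gauss l)" for i
  obtain k where k: "\<And>j. j < p \<Longrightarrow> (\<Sum>i<l. (a i - (\<Sum>r<p. k r * A $$ (r, i))) * A $$ (j, i)) = 0"
    using orthogonal_decomposition[where w = "\<lambda>r i. A $$ (r, i)" and p = p and a = a and l = l] by blast
  define v where "v = vec l (\<lambda>i. a i - (\<Sum>r<p. k r * A $$ (r, i)))"
  have v: "v \<in> carrier_vec l" by (simp add: v_def)
  have Av: "A *\<^sub>v v = 0\<^sub>v p"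
  proof (rule eq_vecI)
    fix j assume "j < dim_vec (0\<^sub>v p :: real vec)"
    then have j: "j < p" by simp
    show "(A *\<^sub>v v) $ j = 0\<^sub>v p $ j"
      unfolding mult_mat_vec_index[OF A v j] using k[OF j] j by (simp add: v_def mult.commute)
  qed (use A in simp)
  have gm: "(\<lambda>x. g (A *\<^sub>v x)) \<in> borel_measurable (vec_borel l)"
    by (rule measurable_compose[OF measurable_mult_mat_vec[OF A] g]) simp
  have "(\<integral>x. g (A *\<^sub>v x) * (v \<bullet> x) \<partial>gauss l) = 0"
  proof (rule gauss_orthogonal_invariant_direction[OF v gm g2])
    fix x :: "real vec" and t :: real assume x: "x \<in> carrier_vec l"
    have "A *\<^sub>v (x + t \<cdot>\<^sub>v v) = A *\<^sub>v x"
      using A x v by (simp add: mult_add_distrib_mat_vec[OF A x] mult_mat_vec[OF A v] Av) auto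
    then show "g (A *\<^sub>v (x + t \<cdot>\<^sub>v v)) = g (A *\<^sub>v x)" by simp
  qed
  moreover have "(\<integral>x. g (A *\<^sub>v x) * (v \<bullet> x) \<partial>gauss l) = (\<Sum>i<l. v $ i * a i)"
  proof -
    have "(\<integral>x. g (A *\<^sub>v x) * (v \<bullet> x) \<partial>gauss l)
        = (\<integral>x. (\<Sum>i<l. v $ i * (g (A *\<^sub>v x) * x $ i)) \<partial>gauss l)"
      by (rule Bochner_Integration.integral_cong)
        (auto simp: scalar_prod_def lessThan_atLeast0 sum_distrib_left mult_ac)
    also have "\<dots> = (\<Sum>i<l. v $ i * a i)"
    proof (subst Bochner_Integration.integral_sum)
      fix i assume i: "i \<in> {..<l}"
      have "integrable (gauss l) (\<lambda>x. (x $ i)\<^sup>2)"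
        using gauss_second_moment(1)[of i l i] i by (simp add: power2_eq_square)
      then have "integrable (gauss l) (\<lambda>x. g (A *\<^sub>v x) * x $ i)"
        using gm i by (intro integrable_mult_of_squares[OF _ _ g2])
          (auto simp: measurable_cong_sets[OF sets_gauss refl] intro: measurable_vec_nth)
      then show "integrable (gauss l) (\<lambda>x. v $ i * (g (A *\<^sub>v x) * x $ i))" by simp
    qed (simp add: a_def)
    finally show ?thesis .
  qed
  ultimately have va: "(\<Sum>i<l. v $ i * a i) = 0" by simp
  have "(\<Sum>i<l. v $ i * v $ i) = (\<Sum>i<l. v $ i * a i) - (\<Sum>r<p. k r * (A *\<^sub>v v) $ r)"
  proof -
    have "(\<Sum>r<p. k r * (A *\<^sub>v v) $ r) = (\<Sum>r<p. \<Sum>i<l. v $ i * (k r * A $$ (r, i)))"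
      by (intro sum.cong refl) (simp add: mult_mat_vec_index[OF A v] sum_distrib_left mult_ac del: index_mult_mat_vec)
    also have "\<dots> = (\<Sum>i<l. v $ i * (\<Sum>r<p. k r * A $$ (r, i)))"
      by (subst sum.swap) (simp add: sum_distrib_left)
    also have "\<dots> = (\<Sum>i<l. v $ i * (a i - v $ i))"
      by (intro sum.cong refl) (simp add: v_def)
    finally show ?thesis by (simp add: right_diff_distrib sum_subtractf)
  qed
  also have "\<dots> = 0" using va by (simp add: Av)
  finally have "\<forall>i<l. v $ i = 0" by (auto simp: sum_nonneg_eq_0_iff)
  then have ai: "a i = (\<Sum>r<p. k r * A $$ (r, i))" if "i < l" for i
    using that by (auto simp: v_def)
  show ?thesis
  proof (intro exI[of _ k] ballI)
    fix x :: "real vec" assume x: "x \<in> carrier_vec l"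
    have "(\<Sum>j<p. k j * (A *\<^sub>v x) $ j) = (\<Sum>j<p. \<Sum>i<l. k j * A $$ (j, i) * x $ i)"
      by (intro sum.cong refl) (simp add: mult_mat_vec_index[OF A x] sum_distrib_left mult_ac del: index_mult_mat_vec)
    also have "\<dots> = (\<Sum>i<l. a i * x $ i)"
      by (subst sum.swap) (simp add: ai sum_distrib_right)
    finally show "(\<Sum>j<p. k j * (A *\<^sub>v x) $ j) = (\<Sum>i<l. (\<integral>x. g (A *\<^sub>v x) * x $ i \<partial>gauss l) * x $ i)"
      by (simp add: a_def)
  qed
qed

text \<open>
  The coordinate functions are orthonormal in \<open>L\<^sup>2(\<mu>)\<close>: the feature that the law of \<open>R\<^sup>T \<xi>\<close> shares
  with the Gaussian law, and enough to determine the cost of a linear policy.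
\<close>

definition orthonormal_coords :: "real vec measure \<Rightarrow> nat \<Rightarrow> bool" where
  "orthonormal_coords \<mu> l \<longleftrightarrow> (\<forall>i<l. \<forall>j<l. integrable \<mu> (\<lambda>x. x $ i * x $ j) \<and>
     (\<integral>x. x $ i * x $ j \<partial>\<mu>) = (if i = j then 1 else 0))"

lemma orthonormal_coords_gauss: "orthonormal_coords (gauss l) l"
  by (simp add: orthonormal_coords_def gauss_second_moment)

lemma integral_double_sum:
  fixes f :: "'i \<Rightarrow> 'j \<Rightarrow> 'a \<Rightarrow> real"
  assumes int: "\<And>i j. i \<in> A \<Longrightarrow> j \<in> B \<Longrightarrow> integrable \<mu> (f i j)"
  shows "integrable \<mu> (\<lambda>x. \<Sum>i\<in>A. \<Sum>j\<in>B. c i j * f i j x)"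
    and "(\<integral>x. (\<Sum>i\<in>A. \<Sum>j\<in>B. c i j * f i j x) \<partial>\<mu>) = (\<Sum>i\<in>A. \<Sum>j\<in>B. c i j * integral\<^sup>L \<mu> (f i j))"
proof -
  have *: "integrable \<mu> (\<lambda>x. c i j * f i j x)" if "i \<in> A" "j \<in> B" for i j
    using int[OF that] by simp
  show "integrable \<mu> (\<lambda>x. \<Sum>i\<in>A. \<Sum>j\<in>B. c i j * f i j x)"
    by (intro Bochner_Integration.integrable_sum *)
  have "(\<integral>x. (\<Sum>i\<in>A. \<Sum>j\<in>B. c i j * f i j x) \<partial>\<mu>) = (\<Sum>i\<in>A. \<integral>x. (\<Sum>j\<in>B. c i j * f i j x) \<partial>\<mu>)"
    by (intro Bochner_Integration.integral_sum Bochner_Integration.integrable_sum *)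
  also have "\<dots> = (\<Sum>i\<in>A. \<Sum>j\<in>B. \<integral>x. c i j * f i j x \<partial>\<mu>)"
    by (intro sum.cong refl Bochner_Integration.integral_sum *)
  finally show "(\<integral>x. (\<Sum>i\<in>A. \<Sum>j\<in>B. c i j * f i j x) \<partial>\<mu>) = (\<Sum>i\<in>A. \<Sum>j\<in>B. c i j * integral\<^sup>L \<mu> (f i j))"
    by simp
qed

lemma orthonormal_coords_linear_pair:
  assumes "orthonormal_coords \<mu> l"
  shows "integrable \<mu> (\<lambda>x. (\<Sum>i<l. a i * x $ i) * (\<Sum>i<l. b i * x $ i))"
    and "(\<integral>x. (\<Sum>i<l. a i * x $ i) * (\<Sum>i<l. b i * x $ i) \<partial>\<mu>) = (\<Sum>i<l. a i * b i)"
proof -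
  have eq: "(\<Sum>i<l. a i * x $ i) * (\<Sum>i<l. b i * x $ i)
      = (\<Sum>i<l. \<Sum>j<l. a i * b j * (x $ i * x $ j))" for x :: "real vec"
    unfolding sum_product by (simp add: mult_ac)
  have int: "integrable \<mu> (\<lambda>x. x $ i * x $ j)" if "i < l" "j < l" for i j
    using assms that by (simp add: orthonormal_coords_def)
  show "integrable \<mu> (\<lambda>x. (\<Sum>i<l. a i * x $ i) * (\<Sum>i<l. b i * x $ i))"
    unfolding eq by (intro integral_double_sum(1) int) auto
  have "(\<integral>x. (\<Sum>i<l. \<Sum>j<l. a i * b j * (x $ i * x $ j)) \<partial>\<mu>)
      = (\<Sum>i<l. \<Sum>j<l. a i * b j * (\<integral>x. x $ i * x $ j \<partial>\<mu>))"
    by (intro integral_double_sum(2) int) auto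
  also have "\<dots> = (\<Sum>i<l. \<Sum>j<l. if i = j then a i * b j else 0)"
    using assms by (intro sum.cong refl) (auto simp: orthonormal_coords_def)
  also have "\<dots> = (\<Sum>i<l. a i * b i)" by simp
  finally show "(\<integral>x. (\<Sum>i<l. a i * x $ i) * (\<Sum>i<l. b i * x $ i) \<partial>\<mu>) = (\<Sum>i<l. a i * b i)"
    unfolding eq .
qed

lemma nn_integral_qform:
  assumes Q: "sym_pos_def m Q"
    and int: "\<And>r s. r < m \<Longrightarrow> s < m \<Longrightarrow> integrable \<mu> (\<lambda>x. y x r * y x s)"
  shows "(\<integral>\<^sup>+ x. ennreal (1/2 * qform m Q (y x)) \<partial>\<mu>)
    = ennreal (1/2 * (\<Sum>r<m. \<Sum>s<m. Q $$ (r, s) * (\<integral>x. y x r * y x s \<partial>\<mu>)))"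
proof -
  have "integrable \<mu> (\<lambda>x. 1/2 * qform m Q (y x))"
    unfolding qform_def by (intro integrable_mult_right integral_double_sum(1) int) auto
  then have "(\<integral>\<^sup>+ x. ennreal (1/2 * qform m Q (y x)) \<partial>\<mu>) = ennreal (\<integral>x. 1/2 * qform m Q (y x) \<partial>\<mu>)"
    by (rule nn_integral_eq_integral) (simp add: qform_nonneg[OF Q])
  also have "(\<integral>x. 1/2 * qform m Q (y x) \<partial>\<mu>)
      = 1/2 * (\<Sum>r<m. \<Sum>s<m. Q $$ (r, s) * (\<integral>x. y x r * y x s \<partial>\<mu>))"
    unfolding qform_def integral_mult_right_zero
    by (intro arg_cong[where f = "(*) (1/2)"] integral_double_sum(2) int) auto
  finally show ?thesis .
qed

lemma shifted_action_linear_policy: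
  assumes "sym_pos_def m Q"
  obtains D where "\<And>r x. r < m \<Longrightarrow> x \<in> carrier_vec (total_dim m ls) \<Longrightarrow>
    shifted_action m ls Q W (linear_policy ls K) x r = (\<Sum>i<total_dim m ls. D r i * x $ i)"
proof
  obtain P where P: "mat_inverse Q = Some P" "P \<in> carrier_mat m m"
    using sym_pos_def_inverse[OF assms] by blast
  have PW: "P * W_env m ls W \<in> carrier_mat m (total_dim m ls)"
    using P(2) W_carrier(1) by (rule mult_carrier_mat)
  fix r and x :: "real vec" assume r: "r < m" and x: "x \<in> carrier_vec (total_dim m ls)"
  have "linear_policy ls K r (W_obs m ls W r *\<^sub>v x)
      = (\<Sum>j<ls r. \<Sum>i<total_dim m ls. K r j * W_obs m ls W r $$ (j, i) * x $ i)"
    unfolding linear_policy_def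
    by (intro sum.cong refl)
      (simp add: mult_mat_vec_index[OF W_carrier(2) x] sum_distrib_left mult_ac del: index_mult_mat_vec)
  also have "\<dots> = (\<Sum>i<total_dim m ls. (\<Sum>j<ls r. K r j * W_obs m ls W r $$ (j, i)) * x $ i)"
    by (subst sum.swap) (simp add: sum_distrib_right)
  finally show "shifted_action m ls Q W (linear_policy ls K) x r
      = (\<Sum>i<total_dim m ls. ((\<Sum>j<ls r. K r j * W_obs m ls W r $$ (j, i))
          + (the (mat_inverse Q) * W_env m ls W) $$ (r, i)) * x $ i)"
    unfolding shifted_action_def P(1) option.sel mult_mat_vec_index[OF PW x r]
    by (simp add: distrib_right sum.distrib)
qed

lemma linear_policy_cost_moments:
  assumes Q: "sym_pos_def m Q"
    and \<mu>: "orthonormal_coords \<mu> (total_dim m ls)" "space \<mu> = carrier_vec (total_dim m ls)"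
    and \<nu>: "orthonormal_coords \<nu> (total_dim m ls)" "space \<nu> = carrier_vec (total_dim m ls)"
  shows "(\<integral>\<^sup>+ y. ennreal (square_loss m ls Q W (linear_policy ls K) y) \<partial>\<mu>)
    = (\<integral>\<^sup>+ y. ennreal (square_loss m ls Q W (linear_policy ls K) y) \<partial>\<nu>)"
    and "(\<integral>\<^sup>+ y. ennreal (square_loss m ls Q W (linear_policy ls K) y) \<partial>\<mu>) < \<infinity>"
proof -
  let ?l = "total_dim m ls"
  obtain D where D: "\<And>r x. r < m \<Longrightarrow> x \<in> carrier_vec ?l \<Longrightarrow>
      shifted_action m ls Q W (linear_policy ls K) x r = (\<Sum>i<?l. D r i * x $ i)"
    using shifted_action_linear_policy[OF Q] by metis
  have *: "(\<integral>\<^sup>+ y. ennreal (square_loss m ls Q W (linear_policy ls K) y) \<partial>\<kappa>)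
      = ennreal (1/2 * (\<Sum>r<m. \<Sum>s<m. Q $$ (r, s) * (\<Sum>i<?l. D r i * D s i)))"
    if \<kappa>: "orthonormal_coords \<kappa> ?l" "space \<kappa> = carrier_vec ?l" for \<kappa>
  proof -
    have "(\<integral>\<^sup>+ y. ennreal (square_loss m ls Q W (linear_policy ls K) y) \<partial>\<kappa>)
        = (\<integral>\<^sup>+ y. ennreal (1/2 * qform m Q (\<lambda>r. \<Sum>i<?l. D r i * y $ i)) \<partial>\<kappa>)"
      by (intro nn_integral_cong) (simp add: square_loss_def qform_def D \<kappa>(2))
    also have "\<dots> = ennreal (1/2 * (\<Sum>r<m. \<Sum>s<m. Q $$ (r, s)
        * (\<integral>y. (\<Sum>i<?l. D r i * y $ i) * (\<Sum>i<?l. D s i * y $ i) \<partial>\<kappa>)))"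
      by (rule nn_integral_qform[OF Q]) (rule orthonormal_coords_linear_pair(1)[OF \<kappa>(1)])
    finally show ?thesis by (simp add: orthonormal_coords_linear_pair(2)[OF \<kappa>(1)])
  qed
  show "(\<integral>\<^sup>+ y. ennreal (square_loss m ls Q W (linear_policy ls K) y) \<partial>\<mu>)
    = (\<integral>\<^sup>+ y. ennreal (square_loss m ls Q W (linear_policy ls K) y) \<partial>\<nu>)"
    using *[OF \<mu>] *[OF \<nu>] by simp
  show "(\<integral>\<^sup>+ y. ennreal (square_loss m ls Q W (linear_policy ls K) y) \<partial>\<mu>) < \<infinity>"
    using *[OF \<mu>] by simp
qed

text \<open>
  The projection onto the linear functions, applied to each component, is orthogonal not only in
  \<open>L\<^sup>2\<close> but also for the form \<open>E[qform m Q y]\<close>, because \<open>Q\<close> mixes components and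
  the projection acts within each of them. So \<open>E[qform m Q y]\<close> drops by \<open>E[qform m Q d] \<ge> 0\<close>, where
  \<open>d\<close> is the residual.
\<close>

lemma linear_projection_decreases_qform:
  fixes y :: "real vec \<Rightarrow> nat \<Rightarrow> real"
  assumes Q: "sym_pos_def m Q" and \<mu>: "orthonormal_coords \<mu> l"
    and meas: "\<And>i. i < l \<Longrightarrow> (\<lambda>x. x $ i) \<in> borel_measurable \<mu>"
    and y: "\<And>r. r < m \<Longrightarrow> (\<lambda>x. y x r) \<in> borel_measurable \<mu>"
    and y2: "\<And>r. r < m \<Longrightarrow> integrable \<mu> (\<lambda>x. (y x r)\<^sup>2)"
  defines "D \<equiv> \<lambda>r i. \<integral>x. y x r * x $ i \<partial>\<mu>"
  shows "(\<integral>\<^sup>+ x. ennreal (1/2 * qform m Q (\<lambda>r. \<Sum>i<l. D r i * x $ i)) \<partial>\<mu>)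
    \<le> (\<integral>\<^sup>+ x. ennreal (1/2 * qform m Q (y x)) \<partial>\<mu>)"
proof -
  let ?h = "\<lambda>x r. \<Sum>i<l. D r i * x $ i"
  define B where "B r s = (\<Sum>i<l. D r i * D s i)" for r s
  have x2: "integrable \<mu> (\<lambda>x. (x $ i)\<^sup>2)" if "i < l" for i
    using \<mu> that by (simp add: orthonormal_coords_def power2_eq_square)
  have iyy: "integrable \<mu> (\<lambda>x. y x r * y x s)" if "r < m" "s < m" for r s
    by (intro integrable_mult_of_squares y y2 that)
  have iyx: "integrable \<mu> (\<lambda>x. y x r * x $ i)" if "r < m" "i < l" for r i
    by (intro integrable_mult_of_squares y y2 meas x2 that)
  have yh: "y x r * ?h x s = (\<Sum>i<l. D s i * (y x r * x $ i))" for x r s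
    by (simp add: sum_distrib_left mult_ac)
  have iyh: "integrable \<mu> (\<lambda>x. y x r * ?h x s)" if "r < m" for r s
    unfolding yh by (intro Bochner_Integration.integrable_sum integrable_mult_right iyx that) auto
  have Eyh: "(\<integral>x. y x r * ?h x s \<partial>\<mu>) = B r s" if "r < m" for r s
    unfolding yh by (simp add: iyx that Bochner_Integration.integral_sum B_def) (simp add: D_def mult.commute)
  have ihh: "integrable \<mu> (\<lambda>x. ?h x r * ?h x s)" for r s
    by (rule orthonormal_coords_linear_pair(1)[OF \<mu>])
  have Ehh: "(\<integral>x. ?h x r * ?h x s \<partial>\<mu>) = B r s" for r s
    unfolding B_def by (rule orthonormal_coords_linear_pair(2)[OF \<mu>])
  define d where "d x r = y x r - ?h x r" for x r
  have dd: "d x r * d x s = (y x r * y x s - y x r * ?h x s) - (y x s * ?h x r - ?h x r * ?h x s)" for x r s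
    by (simp add: d_def algebra_simps)
  have idd: "integrable \<mu> (\<lambda>x. d x r * d x s)" if "r < m" "s < m" for r s
    unfolding dd by (intro Bochner_Integration.integrable_diff iyy iyh ihh that)
  have Edd: "(\<integral>x. d x r * d x s \<partial>\<mu>) = (\<integral>x. y x r * y x s \<partial>\<mu>) - B r s" if "r < m" "s < m" for r s
  proof -
    have "(\<integral>x. d x r * d x s \<partial>\<mu>) = ((\<integral>x. y x r * y x s \<partial>\<mu>) - (\<integral>x. y x r * ?h x s \<partial>\<mu>))
        - ((\<integral>x. y x s * ?h x r \<partial>\<mu>) - (\<integral>x. ?h x r * ?h x s \<partial>\<mu>))"
      unfolding dd
      by (subst Bochner_Integration.integral_diff)
        (auto intro!: Bochner_Integration.integrable_diff iyy iyh ihh that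
          arg_cong2[where f = "(-)"] Bochner_Integration.integral_diff)
    also have "(\<integral>x. y x s * ?h x r \<partial>\<mu>) = B s r" by (rule Eyh[OF that(2)])
    also have "B s r = B r s" by (simp add: B_def mult.commute)
    finally show ?thesis by (simp add: Eyh[OF that(1)] Ehh)
  qed
  have "0 \<le> (\<integral>x. qform m Q (d x) \<partial>\<mu>)"
    by (rule Bochner_Integration.integral_nonneg) (rule qform_nonneg[OF Q])
  also have "\<dots> = (\<Sum>r<m. \<Sum>s<m. Q $$ (r, s) * (\<integral>x. d x r * d x s \<partial>\<mu>))"
    unfolding qform_def by (intro integral_double_sum(2) idd) auto
  also have "\<dots> = (\<Sum>r<m. \<Sum>s<m. Q $$ (r, s) * ((\<integral>x. y x r * y x s \<partial>\<mu>) - B r s))"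
    by (intro sum.cong refl) (simp add: Edd)
  finally have "(\<Sum>r<m. \<Sum>s<m. Q $$ (r, s) * B r s)
      \<le> (\<Sum>r<m. \<Sum>s<m. Q $$ (r, s) * (\<integral>x. y x r * y x s \<partial>\<mu>))"
    by (simp add: right_diff_distrib sum_subtractf)
  moreover have "(\<integral>\<^sup>+ x. ennreal (1/2 * qform m Q (?h x)) \<partial>\<mu>)
      = ennreal (1/2 * (\<Sum>r<m. \<Sum>s<m. Q $$ (r, s) * B r s))"
    by (subst nn_integral_qform[OF Q ihh]) (simp only: Ehh)
  moreover have "(\<integral>\<^sup>+ x. ennreal (1/2 * qform m Q (y x)) \<partial>\<mu>)
      = ennreal (1/2 * (\<Sum>r<m. \<Sum>s<m. Q $$ (r, s) * (\<integral>x. y x r * y x s \<partial>\<mu>)))"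
    by (rule nn_integral_qform[OF Q iyy])
  ultimately show ?thesis by (auto intro!: ennreal_leI)
qed

text \<open>
  Project the actions \<open>\<gamma> r (W\<^sub>r \<zeta>)\<close> onto the linear functions of \<open>\<zeta>\<close>. By
  \<open>gauss_observation_projection\<close> the result is an admissible linear policy; since
  \<open>Q\<^sup>-\<^sup>1 S \<zeta>\<close> is already linear, the shifted actions are projected as well, and
  \<open>linear_projection_decreases_qform\<close> applies to them.
\<close>

lemma gauss_linear_policy_optimal:
  assumes Q: "sym_pos_def m Q" and \<gamma>: "\<gamma> \<in> policies m ls"
  shows "\<exists>K. (\<integral>\<^sup>+ y. ennreal (square_loss m ls Q W (linear_policy ls K) y) \<partial>gauss (total_dim m ls))
    \<le> (\<integral>\<^sup>+ y. ennreal (square_loss m ls Q W \<gamma> y) \<partial>gauss (total_dim m ls))"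
    (is "\<exists>K. ?cost (linear_policy ls K) \<le> ?cost \<gamma>")
proof (cases "?cost \<gamma> = \<infinity>")
  case True
  then show ?thesis by simp
next
  case False
  let ?l = "total_dim m ls"
  obtain P where P: "mat_inverse Q = Some P" "P \<in> carrier_mat m m"
    using sym_pos_def_inverse[OF Q] by blast
  define Z where "Z = P * W_env m ls W"
  have Z: "Z \<in> carrier_mat m ?l"
    unfolding Z_def using P(2) W_carrier(1) by (rule mult_carrier_mat)
  let ?y = "shifted_action m ls Q W \<gamma>"
  let ?u = "\<lambda>r x. \<gamma> r (W_obs m ls W r *\<^sub>v x)"
  have y_eq: "?y x r = ?u r x + (\<Sum>i<?l. Z $$ (r, i) * x $ i)" if "r < m" "x \<in> carrier_vec ?l" for x r
    unfolding shifted_action_def P(1) option.sel Z_def[symmetric] mult_mat_vec_index[OF Z that(2,1)] ..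
  have sq: "integrable (gauss ?l) (square_loss m ls Q W \<gamma>)"
  proof (rule integrableI_nonneg)
    show "square_loss m ls Q W \<gamma> \<in> borel_measurable (gauss ?l)"
      using measurable_square_loss[OF Q \<gamma>] by (simp add: measurable_cong_sets[OF sets_gauss refl])
    show "?cost \<gamma> < \<infinity>" using False by (simp add: top.not_eq_extremum)
  qed (simp add: square_loss_nonneg[OF Q])
  have ym: "(\<lambda>x. ?y x r) \<in> borel_measurable (gauss ?l)" if "r < m" for r
    using measurable_shifted_action[OF Q \<gamma> that] by (simp add: measurable_cong_sets[OF sets_gauss refl])
  have xm: "(\<lambda>x. x $ i) \<in> borel_measurable (gauss ?l)" if "i < ?l" for i
    using measurable_vec_nth[OF that] by (simp add: measurable_cong_sets[OF sets_gauss refl])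
  have y2: "integrable (gauss ?l) (\<lambda>x. (?y x r)\<^sup>2)" if r: "r < m" for r
  proof -
    obtain c where c: "0 \<le> c" "\<And>y. (y r)\<^sup>2 \<le> c * qform m Q y"
      using qform_coercive[OF Q r] by blast
    show ?thesis
    proof (rule Bochner_Integration.integrable_bound)
      show "integrable (gauss ?l) (\<lambda>x. 2 * c * square_loss m ls Q W \<gamma> x)"
        using sq by simp
      show "AE x in gauss ?l. norm ((?y x r)\<^sup>2) \<le> norm (2 * c * square_loss m ls Q W \<gamma> x)"
        using c by (auto intro!: AE_I2 simp: square_loss_def qform_nonneg[OF Q] abs_mult)
    qed (use ym[OF r] in measurable)
  qed
  note moments = orthonormal_coords_gauss[of ?l]
  have ix2: "integrable (gauss ?l) (\<lambda>x. (x $ i)\<^sup>2)" if "i < ?l" for i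
    using moments that by (simp add: orthonormal_coords_def power2_eq_square)
  have lin2: "integrable (gauss ?l) (\<lambda>x. (\<Sum>i<?l. Z $$ (r, i) * x $ i)\<^sup>2)" for r
    using orthonormal_coords_linear_pair(1)[OF moments] by (simp add: power2_eq_square)
  have linm: "(\<lambda>x. \<Sum>i<?l. Z $$ (r, i) * x $ i) \<in> borel_measurable (gauss ?l)" for r
    by (intro borel_measurable_sum borel_measurable_times borel_measurable_const xm) auto
  have u_eq: "?u r x = ?y x r - (\<Sum>i<?l. Z $$ (r, i) * x $ i)" if "r < m" "x \<in> space (gauss ?l)" for x r
    using y_eq that by simp
  have u2: "integrable (gauss ?l) (\<lambda>x. (?u r x)\<^sup>2)" if r: "r < m" for r
  proof -
    have "integrable (gauss ?l) (\<lambda>x. ((?y x r)\<^sup>2 - 2 * (?y x r * (\<Sum>i<?l. Z $$ (r, i) * x $ i)))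
        + (\<Sum>i<?l. Z $$ (r, i) * x $ i)\<^sup>2)"
      by (intro Bochner_Integration.integrable_add Bochner_Integration.integrable_diff
          integrable_mult_right integrable_mult_of_squares ym y2 lin2 linm r)
    then show ?thesis
      by (rule Bochner_Integration.integrable_cong[THEN iffD1, rotated 2])
        (simp_all add: u_eq[OF r] power2_diff del: space_gauss)
  qed
  have "\<exists>k. \<forall>r<m. \<forall>x::real vec\<in>carrier_vec ?l. (\<Sum>j<ls r. k r j * (W_obs m ls W r *\<^sub>v x) $ j)
      = (\<Sum>i<?l. (\<integral>x. ?u r x * x $ i \<partial>gauss ?l) * x $ i)"
    using gauss_observation_projection[OF W_carrier(2) _ u2] \<gamma> unfolding policies_def by (intro choice) blast
  then obtain K where K: "\<And>r x. r < m \<Longrightarrow> x \<in> carrier_vec ?l \<Longrightarrow>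
      linear_policy ls K r (W_obs m ls W r *\<^sub>v x) = (\<Sum>i<?l. (\<integral>x. ?u r x * x $ i \<partial>gauss ?l) * x $ i)"
    unfolding linear_policy_def by blast
  have D: "(\<integral>x. ?y x r * x $ i \<partial>gauss ?l) = (\<integral>x. ?u r x * x $ i \<partial>gauss ?l) + Z $$ (r, i)"
    if r: "r < m" and i: "i < ?l" for r i
  proof -
    let ?e = "\<lambda>j. if j = i then 1 else (0::real)"
    have e: "(\<Sum>j<?l. ?e j * x $ j) = x $ i" for x :: "real vec"
      using i by (simp add: if_distrib[of "\<lambda>t. t * _"] cong: if_cong)
    have "(\<integral>x. (\<Sum>j<?l. Z $$ (r, j) * x $ j) * x $ i \<partial>gauss ?l) = Z $$ (r, i)"
      using orthonormal_coords_linear_pair(2)[OF moments, of "\<lambda>j. Z $$ (r, j)" ?e] i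
      unfolding e by (simp add: if_distrib[of "\<lambda>t. _ * t"] cong: if_cong)
    moreover have "integrable (gauss ?l) (\<lambda>x. (\<Sum>j<?l. Z $$ (r, j) * x $ j) * x $ i)"
      by (intro integrable_mult_of_squares lin2 linm xm ix2 i)
    moreover have "integrable (gauss ?l) (\<lambda>x. ?y x r * x $ i)"
      by (intro integrable_mult_of_squares ym y2 xm ix2 i r)
    moreover have "(\<integral>x. ?u r x * x $ i \<partial>gauss ?l)
        = (\<integral>x. ?y x r * x $ i - (\<Sum>j<?l. Z $$ (r, j) * x $ j) * x $ i \<partial>gauss ?l)"
      by (rule Bochner_Integration.integral_cong)
        (simp_all add: u_eq[OF r] left_diff_distrib del: space_gauss)
    ultimately show ?thesis by simp
  qed
  have "?cost (linear_policy ls K)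
      = (\<integral>\<^sup>+ x. ennreal (1/2 * qform m Q (\<lambda>r. \<Sum>i<?l. (\<integral>x. ?y x r * x $ i \<partial>gauss ?l) * x $ i)) \<partial>gauss ?l)"
  proof (rule nn_integral_cong)
    fix x assume "x \<in> space (gauss ?l)"
    then have x: "x \<in> carrier_vec ?l" by simp
    have "shifted_action m ls Q W (linear_policy ls K) x r
        = (\<Sum>i<?l. (\<integral>x. ?y x r * x $ i \<partial>gauss ?l) * x $ i)" if r: "r < m" for r
    proof -
      have "shifted_action m ls Q W (linear_policy ls K) x r
          = (\<Sum>i<?l. (\<integral>x. ?u r x * x $ i \<partial>gauss ?l) * x $ i) + (\<Sum>i<?l. Z $$ (r, i) * x $ i)"
        unfolding shifted_action_def K[OF r x] P(1) option.sel Z_def[symmetric]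
          mult_mat_vec_index[OF Z x r] ..
      also have "\<dots> = (\<Sum>i<?l. (\<integral>x. ?y x r * x $ i \<partial>gauss ?l) * x $ i)"
        unfolding sum.distrib[symmetric] by (intro sum.cong refl) (simp add: D[OF r] distrib_right)
      finally show ?thesis .
    qed
    then show "ennreal (square_loss m ls Q W (linear_policy ls K) x)
        = ennreal (1/2 * qform m Q (\<lambda>r. \<Sum>i<?l. (\<integral>x. ?y x r * x $ i \<partial>gauss ?l) * x $ i))"
      by (simp add: square_loss_def qform_def)
  qed
  also have "\<dots> \<le> (\<integral>\<^sup>+ x. ennreal (1/2 * qform m Q (?y x)) \<partial>gauss ?l)"
    by (rule linear_projection_decreases_qform[OF Q moments xm ym y2])
  finally show ?thesis by (auto simp: square_loss_def)
qed

section \<open>Projections of isotropic random vectors\<close>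

lemma measurable_mat_index:
  assumes "ij \<in> {..<n} \<times> {..<k}"
  shows "(\<lambda>A. A $$ ij) \<in> borel_measurable (mat_borel n k)"
proof -
  have "(\<lambda>A. \<lambda>ij\<in>{..<n} \<times> {..<k}. A $$ ij)
      \<in> measurable (mat_borel n k) (\<Pi>\<^sub>M ij\<in>{..<n} \<times> {..<k}. borel :: real measure)"
    unfolding mat_borel_def by (rule measurable_vimage_algebra1) (auto simp: space_PiM)
  from measurable_compose[OF this measurable_component_singleton[OF assms]] assms
  show ?thesis by simp
qed

lemma space_mat_borel [simp]: "space (mat_borel n k) = carrier_mat n k"
  by (simp add: mat_borel_def)

lemma measurable_mat_borelI:
  assumes "\<And>\<omega>. \<omega> \<in> space M \<Longrightarrow> X \<omega> \<in> carrier_mat n k"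
    and "\<And>i j. i < n \<Longrightarrow> j < k \<Longrightarrow> (\<lambda>\<omega>. X \<omega> $$ (i, j)) \<in> borel_measurable M"
  shows "X \<in> measurable M (mat_borel n k)"
  unfolding mat_borel_def
  by (rule measurable_vimage_algebra2) (auto intro!: measurable_restrict assms)

lemma measurable_mult_mat:
  assumes U: "U \<in> carrier_mat p n"
  shows "(\<lambda>A. U * A) \<in> measurable (mat_borel n k) (mat_borel p k)"
proof (rule measurable_mat_borelI)
  fix i j assume ij: "i < p" "j < k"
  have "(\<lambda>A. \<Sum>r<n. U $$ (i, r) * A $$ (r, j)) \<in> borel_measurable (mat_borel n k)"
    using ij by (intro borel_measurable_sum borel_measurable_times borel_measurable_const measurable_mat_index) auto
  then show "(\<lambda>A. (U * A) $$ (i, j)) \<in> borel_measurable (mat_borel n k)"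
  proof (rule measurable_cong[THEN iffD1, rotated])
    fix A :: "real mat" assume "A \<in> space (mat_borel n k)"
    then show "(\<Sum>r<n. U $$ (i, r) * A $$ (r, j)) = (U * A) $$ (i, j)"
      using U ij by (auto simp: scalar_prod_def lessThan_atLeast0)
  qed
qed (use U in auto)

lemma vec_ball_measurable: "vec_ball l r \<in> sets (vec_borel l)"
proof -
  have "(\<lambda>x. sqrt (\<Sum>i<l. x $ i * x $ i)) \<in> borel_measurable (vec_borel l)"
    by (intro measurable_compose[OF _ borel_measurable_sqrt] borel_measurable_sum
        borel_measurable_times measurable_vec_nth) auto
  then have "vec_norm \<in> borel_measurable (vec_borel l)"
    by (rule measurable_cong[THEN iffD1, rotated])
      (auto simp: vec_norm_def scalar_prod_def lessThan_atLeast0)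
  then have "{x \<in> space (vec_borel l). vec_norm x \<le> r} \<in> sets (vec_borel l)"
    by measurable
  then show ?thesis by (simp add: vec_ball_def)
qed

lemma isotropic_second_moment:
  assumes "prob_space M" and X: "isotropic M n X"
  shows "orthonormal_coords (distr M (vec_borel n) X) n"
  unfolding orthonormal_coords_def
proof (intro allI impI)
  interpret prob_space M by fact
  have Xm: "X \<in> measurable M (vec_borel n)" using X by (simp add: isotropic_def)
  fix i j assume i: "i < n" and j: "j < n"
  have xx: "(\<lambda>x. x $ i * x $ j) \<in> borel_measurable (vec_borel n)"
    using i j by (intro borel_measurable_times measurable_vec_nth)
  have int: "integrable M (\<lambda>\<omega>. X \<omega> $ i * X \<omega> $ j)"
    using X i j Xm by (intro integrable_mult_of_squares measurable_vec_index) (auto simp: isotropic_def)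
  have mean: "mean_vec M n X $ r = 0" if "r < n" for r
    using X that by (simp add: isotropic_def)
  have "(\<integral>\<omega>. X \<omega> $ i * X \<omega> $ j \<partial>M) = cov_mat M n X $$ (i, j)"
    using i j by (simp add: cov_mat_def mean)
  also have "\<dots> = (if i = j then 1 else 0)"
    using X i j by (simp add: isotropic_def)
  finally show "integrable (distr M (vec_borel n) X) (\<lambda>x. x $ i * x $ j) \<and>
      (\<integral>x. x $ i * x $ j \<partial>distr M (vec_borel n) X) = (if i = j then 1 else 0)"
    using int by (simp add: integrable_distr_eq[OF Xm xx] integral_distr[OF Xm xx])
qed

text \<open>
  The coordinates of \<open>R\<^sup>T x\<close> are linear functions of \<open>x\<close> whose coefficient vectors, the columns of
  \<open>R\<close>, are orthonormal.
\<close>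

lemma orthonormal_coords_stiefel:
  assumes \<mu>: "orthonormal_coords \<mu> n" and sets: "sets \<mu> = sets (vec_borel n)"
    and R: "R \<in> stiefel n l"
  shows "orthonormal_coords (distr \<mu> (vec_borel l) (\<lambda>x. R\<^sup>T *\<^sub>v x)) l"
  unfolding orthonormal_coords_def
proof (intro allI impI)
  have Rc: "R \<in> carrier_mat n l" and RR: "R\<^sup>T * R = 1\<^sub>m l" using R by (auto simp: stiefel_def)
  have RT: "R\<^sup>T \<in> carrier_mat l n" using Rc by simp
  have space: "space \<mu> = carrier_vec n" using sets_eq_imp_space_eq[OF sets] by simp
  have m: "(\<lambda>x. R\<^sup>T *\<^sub>v x) \<in> measurable \<mu> (vec_borel l)"
    by (rule measurable_mult_mat_vec[OF RT]) (simp add: measurable_cong_sets[OF sets refl])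
  fix i j assume i: "i < l" and j: "j < l"
  have xx: "(\<lambda>x. x $ i * x $ j) \<in> borel_measurable (vec_borel l)"
    using i j by (intro borel_measurable_times measurable_vec_nth)
  have coord: "(R\<^sup>T *\<^sub>v x) $ r = (\<Sum>a<n. R $$ (a, r) * x $ a)" if "x \<in> space \<mu>" "r < l" for x r
    using that Rc by (subst mult_mat_vec_index[OF RT]) (auto simp: space)
  have pair: "(R\<^sup>T *\<^sub>v x) $ i * (R\<^sup>T *\<^sub>v x) $ j
      = (\<Sum>a<n. R $$ (a, i) * x $ a) * (\<Sum>a<n. R $$ (a, j) * x $ a)" if "x \<in> space \<mu>" for x
    by (simp only: coord[OF that i] coord[OF that j])
  have "(\<Sum>a<n. R $$ (a, i) * R $$ (a, j)) = (R\<^sup>T * R) $$ (i, j)"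
    using Rc i j by (simp add: scalar_prod_def lessThan_atLeast0)
  also have "\<dots> = (if i = j then 1 else 0)"
    unfolding RR using i j by simp
  finally have \<delta>: "(\<Sum>a<n. R $$ (a, i) * R $$ (a, j)) = (if i = j then 1 else 0)" .
  have "integrable \<mu> (\<lambda>x. (R\<^sup>T *\<^sub>v x) $ i * (R\<^sup>T *\<^sub>v x) $ j)"
    by (subst Bochner_Integration.integrable_cong[OF refl pair], assumption)
      (rule orthonormal_coords_linear_pair(1)[OF \<mu>])
  moreover have "(\<integral>x. (R\<^sup>T *\<^sub>v x) $ i * (R\<^sup>T *\<^sub>v x) $ j \<partial>\<mu>) = (if i = j then 1 else 0)"
    by (subst Bochner_Integration.integral_cong[OF refl pair], assumption)
      (simp add: orthonormal_coords_linear_pair(2)[OF \<mu>] \<delta>)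
  ultimately show "integrable (distr \<mu> (vec_borel l) (\<lambda>x. R\<^sup>T *\<^sub>v x)) (\<lambda>x. x $ i * x $ j) \<and>
      (\<integral>x. x $ i * x $ j \<partial>distr \<mu> (vec_borel l) (\<lambda>x. R\<^sup>T *\<^sub>v x)) = (if i = j then 1 else 0)"
    by (simp only: integrable_distr_eq[OF m xx] integral_distr[OF m xx] simp_thms)
qed

lemma projected_orthonormal_coords:
  assumes M: "prob_space M" and X: "isotropic M n X" and R: "R \<in> stiefel n l"
  shows "orthonormal_coords (distr M (vec_borel l) (\<lambda>\<omega>. R\<^sup>T *\<^sub>v X \<omega>)) l"
proof -
  have Xm: "X \<in> measurable M (vec_borel n)" using X by (simp add: isotropic_def)
  have RT: "R\<^sup>T \<in> carrier_mat l n" using R by (auto simp: stiefel_def)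
  have "distr (distr M (vec_borel n) X) (vec_borel l) (\<lambda>x. R\<^sup>T *\<^sub>v x)
      = distr M (vec_borel l) (\<lambda>\<omega>. R\<^sup>T *\<^sub>v X \<omega>)"
    by (subst distr_distr[OF measurable_mult_mat_vec[OF RT] Xm]) (simp_all add: comp_def)
  then show ?thesis
    using orthonormal_coords_stiefel[OF isotropic_second_moment[OF M X] _ R] by simp
qed

lemma indep_elements_project_swap:
  assumes M: "prob_space M" and k: "k \<in> I"
    and indep: "indep_elements M (\<Pi>\<^sub>M i\<in>I. A i) (\<lambda>\<omega>. \<lambda>i\<in>I. X i \<omega>) (\<Pi>\<^sub>M i\<in>I. B i) (\<lambda>\<omega>. \<lambda>i\<in>I. Y i \<omega>)"
  shows "indep_elements M (B k) (Y k) (A k) (X k)"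
proof -
  interpret prob_space M by fact
  let ?X = "\<lambda>\<omega>. \<lambda>i\<in>I. X i \<omega>" and ?Y = "\<lambda>\<omega>. \<lambda>i\<in>I. Y i \<omega>"
  have Xm: "?X \<in> measurable M (\<Pi>\<^sub>M i\<in>I. A i)" and Ym: "?Y \<in> measurable M (\<Pi>\<^sub>M i\<in>I. B i)"
    and prod: "\<And>S T. S \<in> sets (\<Pi>\<^sub>M i\<in>I. A i) \<Longrightarrow> T \<in> sets (\<Pi>\<^sub>M i\<in>I. B i) \<Longrightarrow>
      prob ((?X -` S \<inter> space M) \<inter> (?Y -` T \<inter> space M))
        = prob (?X -` S \<inter> space M) * prob (?Y -` T \<inter> space M)"
    using indep unfolding indep_elements_def indep_sets2_eq by blast+
  have cA: "(\<lambda>f. f k) \<in> measurable (\<Pi>\<^sub>M i\<in>I. A i) (A k)"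
    and cB: "(\<lambda>f. f k) \<in> measurable (\<Pi>\<^sub>M i\<in>I. B i) (B k)"
    by (rule measurable_component_singleton[OF k])+
  have Xk: "X k \<in> measurable M (A k)"
    using measurable_compose[OF Xm cA] k by simp
  have Yk: "Y k \<in> measurable M (B k)"
    using measurable_compose[OF Ym cB] k by simp
  have "prob ((Y k -` T \<inter> space M) \<inter> (X k -` S \<inter> space M))
      = prob (Y k -` T \<inter> space M) * prob (X k -` S \<inter> space M)"
    if S: "S \<in> sets (A k)" and T: "T \<in> sets (B k)" for S T
  proof -
    let ?S = "(\<lambda>f. f k) -` S \<inter> space (\<Pi>\<^sub>M i\<in>I. A i)" and ?T = "(\<lambda>f. f k) -` T \<inter> space (\<Pi>\<^sub>M i\<in>I. B i)"
    have "?S \<in> sets (\<Pi>\<^sub>M i\<in>I. A i)" "?T \<in> sets (\<Pi>\<^sub>M i\<in>I. B i)"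
      using measurable_sets[OF cA S] measurable_sets[OF cB T] by auto
    from prod[OF this] show ?thesis
    proof -
      have "?X -` ?S \<inter> space M = X k -` S \<inter> space M"
        using measurable_space[OF Xm] k by auto
      moreover have "?Y -` ?T \<inter> space M = Y k -` T \<inter> space M"
        using measurable_space[OF Ym] k by auto
      ultimately show ?thesis
        using prod[OF \<open>?S \<in> _\<close> \<open>?T \<in> _\<close>] by (simp add: Int_commute mult.commute)
    qed
  qed
  then show ?thesis
    using Xk Yk unfolding indep_elements_def indep_sets2_eq
    by (auto intro: measurable_sets)
qed

section \<open>Comparison with the Gaussian law\<close>

text \<open>
  The Eldan-Klartag property is formulated for random elements on one fixed type of sample space.
  It carries over to an arbitrary space because it concerns the joint law of
  \<open>(X, R)\<close> only: it is applied to the two projections on that law. The law is restricted to pairs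
  whose second component lies on the Stiefel manifold, since uniformity asks \<open>R\<close> to lie there
  everywhere and not just almost surely.
\<close>

lemma eldan_klartag_any_space:
  fixes M :: "'a measure"
  assumes ek: "eldan_klartag C c1 c2 c3 c4"
    and M: "prob_space M" and X: "isotropic M n X" "has_log_concave_density M n X"
    and l: "1 \<le> l" "real l \<le> real n powr c1"
    and R: "uniform_on_stiefel M n l R"
    and indep: "indep_elements M (vec_borel n) X (mat_borel n l) R"
  shows "with_prob_at_least M (1 - C * exp (- (real n powr c2))) (\<lambda>\<omega>.
    \<exists>f. (\<forall>x. 0 \<le> f x) \<and>
      distributed M (vec_lborel l) (\<lambda>\<omega>'. (R \<omega>)\<^sup>T *\<^sub>v X \<omega>') (\<lambda>x. ennreal (f x)) \<and>
      (\<forall>x\<in>carrier_vec l. vec_norm x \<le> real n powr c4 \<longrightarrow>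
        \<bar>f x / std_normal_vec_density l x - 1\<bar> \<le> C / real n powr c3))"
proof -
  interpret M: prob_space M by fact
  define B where "B = restrict_space (vec_borel n \<Otimes>\<^sub>M mat_borel n l) (UNIV \<times> stiefel n l)"
  define T where "T \<omega> = (X \<omega>, R \<omega>)" for \<omega>
  define M' where "M' = distr M B T"
  have Xm: "X \<in> measurable M (vec_borel n)" and Rm: "R \<in> measurable M (mat_borel n l)"
    using X(1) R by (auto simp: isotropic_def uniform_on_stiefel_def)
  have T: "T \<in> measurable M B"
    unfolding B_def T_def
    by (rule measurable_restrict_space2) (use R Xm Rm in \<open>auto simp: uniform_on_stiefel_def\<close>)
  have setsM' [simp]: "sets M' = sets B" and spaceM' [simp]: "space M' = space B"
    by (simp_all add: M'_def)
  have fstm: "fst \<in> measurable B (vec_borel n)" and sndm: "snd \<in> measurable B (mat_borel n l)"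
    unfolding B_def by (auto intro: measurable_restrict_space1)
  have fstm': "fst \<in> measurable M' (vec_borel n)" and sndm': "snd \<in> measurable M' (mat_borel n l)"
    using fstm sndm by (simp_all cong: measurable_cong_sets)
  have law: "distr M' N g = distr M N (\<lambda>\<omega>. g (X \<omega>, R \<omega>))" if "g \<in> measurable B N" for N and g :: "_ \<Rightarrow> 'z"
    unfolding M'_def by (subst distr_distr[OF that T]) (simp add: comp_def T_def)
  interpret M': prob_space M'
    unfolding M'_def by (rule M.prob_space_distr[OF T])
  have int: "integrable M' (\<lambda>w. g (fst w)) \<longleftrightarrow> integrable M (\<lambda>\<omega>. g (X \<omega>))"
    and lint: "(\<integral>w. g (fst w) \<partial>M') = (\<integral>\<omega>. g (X \<omega>) \<partial>M)"
    if g: "g \<in> borel_measurable (vec_borel n)" for g :: "real vec \<Rightarrow> real"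
    using integrable_distr_eq[OF T measurable_compose[OF fstm g]]
      integral_distr[OF T measurable_compose[OF fstm g]] by (simp_all add: M'_def T_def)
  have mean: "mean_vec M' n fst = mean_vec M n X"
    unfolding mean_vec_def by (intro eq_vecI) (auto intro!: lint measurable_vec_nth)
  have cov: "cov_mat M' n fst = cov_mat M n X"
    unfolding cov_mat_def mean
    by (intro eq_matI)
      (auto intro!: lint borel_measurable_times borel_measurable_diff measurable_vec_nth)
  have sq: "integrable M' (\<lambda>w. (fst w $ i)\<^sup>2) \<longleftrightarrow> integrable M (\<lambda>\<omega>. (X \<omega> $ i)\<^sup>2)" if "i < n" for i
    using that by (intro int borel_measurable_power measurable_vec_nth)
  have isoM': "isotropic M' n fst"
    using X(1) fstm' unfolding isotropic_def mean cov by (auto simp: sq)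
  have lcM': "has_log_concave_density M' n fst"
  proof -
    obtain f where f: "log_concave n f" "distributed M (vec_lborel n) X (\<lambda>x. ennreal (f x))"
      using X(2) by (auto simp: has_log_concave_density_def)
    have "distr M' (vec_lborel n) fst = distr M (vec_lborel n) X"
      using law[of fst "vec_lborel n"] fstm by (simp cong: measurable_cong_sets)
    then have "distributed M' (vec_lborel n) fst (\<lambda>x. ennreal (f x))"
      using f(2) fstm' by (simp add: distributed_def cong: measurable_cong_sets)
    then show ?thesis using f(1) by (auto simp: has_log_concave_density_def)
  qed
  have unifM': "uniform_on_stiefel M' n l snd"
    unfolding uniform_on_stiefel_def
  proof (intro conjI ballI)
    show "snd w \<in> stiefel n l" if "w \<in> space M'" for w
      using that by (auto simp: B_def space_restrict_space)
    fix U :: "real mat" assume U: "U \<in> stiefel n n"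
    then have "U \<in> carrier_mat n n" by (simp add: stiefel_def)
    from measurable_compose[OF sndm measurable_mult_mat[OF this]]
    show "distr M' (mat_borel n l) (\<lambda>\<omega>. U * snd \<omega>) = distr M' (mat_borel n l) snd"
      using R U by (simp add: law sndm uniform_on_stiefel_def)
  qed (rule sndm')
  have indepM': "indep_elements M' (vec_borel n) fst (mat_borel n l) snd"
  proof -
    have prob': "M'.prob (g -` S \<inter> space M') = M.prob ((\<lambda>\<omega>. g (X \<omega>, R \<omega>)) -` S \<inter> space M)"
      if "g \<in> measurable B N" "S \<in> sets N" for g :: "_ \<Rightarrow> 'z" and N S
    proof -
      have "T -` (g -` S \<inter> space B) \<inter> space M = (\<lambda>\<omega>. g (X \<omega>, R \<omega>)) -` S \<inter> space M"
        using measurable_space[OF T] by (auto simp: T_def)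
      then show ?thesis
        using measure_distr[OF T measurable_sets[OF that]] by (simp add: M'_def)
    qed
    have "M'.prob ((fst -` S \<inter> space M') \<inter> (snd -` S' \<inter> space M'))
        = M'.prob (fst -` S \<inter> space M') * M'.prob (snd -` S' \<inter> space M')"
      if S: "S \<in> sets (vec_borel n)" and S': "S' \<in> sets (mat_borel n l)" for S S'
    proof -
      have "(fst -` S \<inter> space M') \<inter> (snd -` S' \<inter> space M')
          = (\<lambda>w. (fst w, snd w)) -` (S \<times> S') \<inter> space M'" by auto
      also have "M'.prob \<dots> = M.prob ((\<lambda>\<omega>. (X \<omega>, R \<omega>)) -` (S \<times> S') \<inter> space M)"
        using prob'[OF measurable_Pair[OF fstm sndm] pair_measureI[OF S S']] by simp
      also have "(\<lambda>\<omega>. (X \<omega>, R \<omega>)) -` (S \<times> S') \<inter> space M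
          = (X -` S \<inter> space M) \<inter> (R -` S' \<inter> space M)" by auto
      also have "M.prob \<dots> = M.prob (X -` S \<inter> space M) * M.prob (R -` S' \<inter> space M)"
        using indep S S' unfolding indep_elements_def M.indep_sets2_eq by blast
      finally show ?thesis
        by (simp add: prob'[OF fstm S, simplified] prob'[OF sndm S', simplified])
    qed
    then show ?thesis
      using fstm' sndm' unfolding indep_elements_def M'.indep_sets2_eq
      by (auto dest: measurable_sets simp del: setsM' spaceM')
  qed
  have "with_prob_at_least M' (1 - C * exp (- (real n powr c2))) (\<lambda>w.
    \<exists>f. (\<forall>x. 0 \<le> f x) \<and>
      distributed M' (vec_lborel l) (\<lambda>w'. (snd w)\<^sup>T *\<^sub>v fst w') (\<lambda>x. ennreal (f x)) \<and>
      (\<forall>x\<in>carrier_vec l. vec_norm x \<le> real n powr c4 \<longrightarrow>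
        \<bar>f x / std_normal_vec_density l x - 1\<bar> \<le> C / real n powr c3))"
    using ek M'.prob_space_axioms isoM' lcM' l unifM' indepM' unfolding eldan_klartag_def by blast
  then obtain E where E: "E \<in> sets M'" "M'.prob E \<ge> 1 - C * exp (- (real n powr c2))"
    and good: "\<And>w. w \<in> E \<Longrightarrow> \<exists>f. (\<forall>x. 0 \<le> f x) \<and>
      distributed M' (vec_lborel l) (\<lambda>w'. (snd w)\<^sup>T *\<^sub>v fst w') (\<lambda>x. ennreal (f x)) \<and>
      (\<forall>x\<in>carrier_vec l. vec_norm x \<le> real n powr c4 \<longrightarrow>
        \<bar>f x / std_normal_vec_density l x - 1\<bar> \<le> C / real n powr c3)"
    unfolding with_prob_at_least_def by blast
  show ?thesis
    unfolding with_prob_at_least_def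
  proof (intro bexI[of _ "T -` E \<inter> space M"] conjI ballI)
    show "T -` E \<inter> space M \<in> sets M" using T E(1) by (auto intro: measurable_sets)
    show "1 - C * exp (- (real n powr c2)) \<le> M.prob (T -` E \<inter> space M)"
      using E measure_distr[OF T, of E] by (simp add: M'_def)
    fix \<omega> assume \<omega>: "\<omega> \<in> T -` E \<inter> space M"
    then obtain f where f: "\<forall>x. 0 \<le> f x"
      "distributed M' (vec_lborel l) (\<lambda>w'. (R \<omega>)\<^sup>T *\<^sub>v fst w') (\<lambda>x. ennreal (f x))"
      "\<forall>x\<in>carrier_vec l. vec_norm x \<le> real n powr c4 \<longrightarrow>
        \<bar>f x / std_normal_vec_density l x - 1\<bar> \<le> C / real n powr c3"
      using good[of "T \<omega>"] by (auto simp: T_def)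
    have g: "(\<lambda>w'. (R \<omega>)\<^sup>T *\<^sub>v fst w') \<in> measurable B (vec_lborel l)"
      using f(2) by (simp add: distributed_def cong: measurable_cong_sets)
    have "(\<lambda>\<omega>'. (R \<omega>)\<^sup>T *\<^sub>v X \<omega>') \<in> measurable M (vec_lborel l)"
      using measurable_compose[OF T g] by (simp add: T_def)
    then have "distributed M (vec_lborel l) (\<lambda>\<omega>'. (R \<omega>)\<^sup>T *\<^sub>v X \<omega>') (\<lambda>x. ennreal (f x))"
      using f(2) law[OF g] by (simp add: distributed_def)
    then show "\<exists>f. (\<forall>x. 0 \<le> f x) \<and>
      distributed M (vec_lborel l) (\<lambda>\<omega>'. (R \<omega>)\<^sup>T *\<^sub>v X \<omega>') (\<lambda>x. ennreal (f x)) \<and>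
      (\<forall>x\<in>carrier_vec l. vec_norm x \<le> real n powr c4 \<longrightarrow>
        \<bar>f x / std_normal_vec_density l x - 1\<bar> \<le> C / real n powr c3)"
      using f by blast
  qed
qed

text \<open>
  On \<open>A\<close> the density \<open>f\<close> is at least \<open>1 - \<epsilon>\<close> times the Gaussian one, and outside \<open>A\<close> the
  nonnegative integrand may be dropped.
\<close>

lemma near_gauss_cost_lower_bound:
  fixes f g :: "real vec \<Rightarrow> real"
  assumes f: "\<And>x. 0 \<le> f x" and fm: "f \<in> borel_measurable (vec_borel l)"
    and near: "\<And>x. x \<in> A \<Longrightarrow> \<bar>f x / std_normal_vec_density l x - 1\<bar> \<le> \<epsilon>"
    and \<epsilon>: "\<epsilon> < 1"
    and A: "A \<in> sets (vec_borel l)"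
    and g: "\<And>x. 0 \<le> g x" and gm: "g \<in> borel_measurable (vec_borel l)"
  shows "ennreal (1 - \<epsilon>) * (\<integral>\<^sup>+ x. ennreal (indicator A x * g x) \<partial>gauss l)
    \<le> (\<integral>\<^sup>+ x. ennreal (g x) \<partial>density (vec_lborel l) (\<lambda>x. ennreal (f x)))"
proof -
  note [measurable] = fm A gm
  let ?\<phi> = "std_normal_vec_density l"
  have "ennreal (1 - \<epsilon>) * (\<integral>\<^sup>+ x. ennreal (indicator A x * g x) \<partial>gauss l)
      = (\<integral>\<^sup>+ x. ennreal (1 - \<epsilon>) * (ennreal (?\<phi> x) * ennreal (indicator A x * g x)) \<partial>vec_lborel l)"
    unfolding gauss_def by (subst nn_integral_density) (simp_all add: nn_integral_cmult)
  also have "\<dots> \<le> (\<integral>\<^sup>+ x. ennreal (f x) * ennreal (g x) \<partial>vec_lborel l)"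
  proof (rule nn_integral_mono)
    fix x
    have pos: "0 < ?\<phi> x" by (rule std_normal_vec_density_pos)
    have "(1 - \<epsilon>) * (?\<phi> x * (indicator A x * g x)) \<le> f x * g x"
    proof (cases "x \<in> A")
      case True
      have "1 - \<epsilon> \<le> f x / ?\<phi> x" using near[OF True] by linarith
      then have "(1 - \<epsilon>) * ?\<phi> x \<le> f x" using pos by (simp add: field_simps)
      then have "((1 - \<epsilon>) * ?\<phi> x) * g x \<le> f x * g x" by (rule mult_right_mono[OF _ g])
      then show ?thesis using True by (simp add: mult.assoc)
    qed (simp add: f g)
    then show "ennreal (1 - \<epsilon>) * (ennreal (?\<phi> x) * ennreal (indicator A x * g x)) \<le> ennreal (f x) * ennreal (g x)"
      using \<epsilon> pos f g by (simp add: ennreal_mult[symmetric] ennreal_leI)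
  qed
  also have "\<dots> = (\<integral>\<^sup>+ x. ennreal (g x) \<partial>density (vec_lborel l) (\<lambda>x. ennreal (f x)))"
    by (rule nn_integral_density[symmetric]) measurable
  finally show ?thesis .
qed

section \<open>Bounds on the optimal cost\<close>

theorem mainTheorem2:
  fixes C c1 c2 c3 c4 :: real
    and m n :: nat and ls :: "nat \<Rightarrow> nat" and Q W :: "real mat"
    and M :: "'a measure" and R :: "nat \<Rightarrow> 'a \<Rightarrow> real mat" and \<xi> :: "nat \<Rightarrow> 'a \<Rightarrow> real vec"
    and \<gamma>opt :: "nat \<Rightarrow> real mat \<Rightarrow> nat \<Rightarrow> real vec \<Rightarrow> real"
    and N :: "'b measure" and \<zeta> :: "'b \<Rightarrow> real vec"
    and \<gamma>G :: "nat \<Rightarrow> real vec \<Rightarrow> real"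
  defines "l \<equiv> total_dim m ls"
    and "\<epsilon> \<equiv> C / real n powr c3"
  assumes constants: "eldan_klartag C c1 c2 c3 c4"
    and ensemble: "team_ensemble M m ls Q W R \<xi>"
    and isotropic: "\<And>k. k \<ge> l \<Longrightarrow> isotropic M k (\<xi> k)"
    and log_concave: "\<And>k. k \<ge> l \<Longrightarrow> has_log_concave_density M k (\<xi> k)"
    and solutions: "\<And>k \<omega>. k \<ge> l \<Longrightarrow> \<omega> \<in> space M \<Longrightarrow>
      team_solution m ls Q W (R k \<omega>) M (\<xi> k) (\<gamma>opt k (R k \<omega>))"
    and N: "prob_space N"
    and gaussian: "distributed N (vec_lborel l) \<zeta> (\<lambda>x. ennreal (std_normal_vec_density l x))"
    and gauss_solution: "gauss_solution m ls Q W N \<zeta> \<gamma>G"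
    and n: "n \<ge> l" "real n \<ge> real l powr (1 / c1)" "\<epsilon> < 1"
  shows "with_prob_at_least M (1 - C * exp (- (real n powr c2))) (\<lambda>\<omega>.
    gauss_cost m ls Q W N \<zeta> \<gamma>G \<ge> team_cost m ls Q W (R n \<omega>) M (\<xi> n) (\<gamma>opt n (R n \<omega>)) \<and>
    team_cost m ls Q W (R n \<omega>) M (\<xi> n) (\<gamma>opt n (R n \<omega>)) \<ge>
      gauss_value_on m ls Q W (vec_ball l (real n powr c4)) N \<zeta>
        - ereal (\<epsilon> / (1 - \<epsilon>)) * gauss_cost m ls Q W N \<zeta> \<gamma>G)"
proof -
  let ?loss = "square_loss m ls Q W" and ?A = "vec_ball l (real n powr c4)"
  let ?p = "1 - C * exp (- (real n powr c2))"
  have M: "prob_space M" and Q: "sym_pos_def m Q" and R: "uniform_on_stiefel M n l (R n)"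
    using ensemble n(1) by (auto simp: team_ensemble_def l_def)
  interpret M: prob_space M by fact
  have C: "C > 0" "c1 > 0" using constants by (auto simp: eldan_klartag_def)
  have \<epsilon>: "0 \<le> \<epsilon>" using C by (simp add: \<epsilon>_def)
  have \<xi>: "\<xi> n \<in> measurable M (vec_borel n)"
    using isotropic[OF n(1)] by (simp add: isotropic_def)
  have \<zeta>: "\<zeta> \<in> measurable N (vec_borel l)" and law\<zeta>: "distr N (vec_borel l) \<zeta> = gauss l"
  proof -
    show "\<zeta> \<in> measurable N (vec_borel l)"
      using gaussian by (simp add: distributed_def cong: measurable_cong_sets)
    have "distr N (vec_borel l) \<zeta> = distr N (vec_lborel l) \<zeta>"
      by (rule distr_cong) simp_all
    then show "distr N (vec_borel l) \<zeta> = gauss l"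
      using gaussian by (simp add: distributed_def gauss_def)
  qed
  define cost where "cost \<mu> \<gamma> = (\<integral>\<^sup>+ y. ennreal (?loss \<gamma> y) \<partial>\<mu>)" for \<mu> \<gamma>
  define cost_on where "cost_on \<gamma> = (\<integral>\<^sup>+ y. ennreal (indicator ?A y * ?loss \<gamma> y) \<partial>gauss l)" for \<gamma>
  define law where "law \<omega> = distr M (vec_borel l) (\<lambda>\<omega>'. (R n \<omega>)\<^sup>T *\<^sub>v \<xi> n \<omega>')" for \<omega>
  define \<gamma>n where "\<gamma>n \<omega> = \<gamma>opt n (R n \<omega>)" for \<omega>
  have stiefel: "R n \<omega> \<in> stiefel n l" and Rc: "R n \<omega> \<in> carrier_mat n l" if "\<omega> \<in> space M" for \<omega>
    using R that by (auto simp: uniform_on_stiefel_def stiefel_def)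
  have team: "team_cost m ls Q W (R n \<omega>) M (\<xi> n) \<gamma> = enn2ereal (cost (law \<omega>) \<gamma>)"
    if "\<omega> \<in> space M" "\<gamma> \<in> policies m ls" for \<omega> \<gamma>
    using team_cost_eq_law[OF Q that(2) Rc[OF that(1), unfolded l_def] \<xi>]
    by (simp add: cost_def law_def l_def)
  have gc: "gauss_cost m ls Q W N \<zeta> \<gamma> = enn2ereal (cost (gauss l) \<gamma>)" if "\<gamma> \<in> policies m ls" for \<gamma>
    using gauss_cost_eq[OF Q that \<zeta>[unfolded l_def] law\<zeta>[unfolded l_def]]
    by (simp add: cost_def l_def)
  have gco: "gauss_cost_on m ls Q W ?A N \<zeta> \<gamma> = enn2ereal (cost_on \<gamma>)" if "\<gamma> \<in> policies m ls" for \<gamma>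
    using gauss_cost_on_eq[OF Q that \<zeta>[unfolded l_def] law\<zeta>[unfolded l_def] vec_ball_measurable]
    by (simp add: cost_on_def l_def)
  have \<gamma>n: "\<gamma>n \<omega> \<in> policies m ls"
    and \<gamma>n_opt: "\<And>\<gamma>. \<gamma> \<in> policies m ls \<Longrightarrow> cost (law \<omega>) (\<gamma>n \<omega>) \<le> cost (law \<omega>) \<gamma>"
    if "\<omega> \<in> space M" for \<omega>
    using solutions[OF n(1) that] team[OF that]
    by (auto simp: team_solution_def \<gamma>n_def less_eq_ennreal.rep_eq)
  have \<gamma>G: "\<gamma>G \<in> policies m ls"
    and \<gamma>G_opt: "\<And>\<gamma>. \<gamma> \<in> policies m ls \<Longrightarrow> cost (gauss l) \<gamma>G \<le> cost (gauss l) \<gamma>"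
    using gauss_solution gc by (auto simp: team_solution_def less_eq_ennreal.rep_eq)
  obtain K where K: "cost (gauss l) (linear_policy ls K) \<le> cost (gauss l) \<gamma>G"
    using gauss_linear_policy_optimal[OF Q \<gamma>G] unfolding cost_def l_def by blast
  have moments: "cost (law \<omega>) (linear_policy ls K) = cost (gauss l) (linear_policy ls K)"
    and fin: "cost (gauss l) (linear_policy ls K) < \<infinity>" if "\<omega> \<in> space M" for \<omega>
    using linear_policy_cost_moments[OF Q, of "law \<omega>" ls "gauss l"]
      linear_policy_cost_moments(2)[OF Q, of "gauss l" ls "gauss l"]
      projected_orthonormal_coords[OF M isotropic[OF n(1)] stiefel[OF that]] orthonormal_coords_gauss[of l]
    by (simp_all add: cost_def law_def l_def)
  have upper: "cost (law \<omega>) (\<gamma>n \<omega>) \<le> cost (gauss l) \<gamma>G" if "\<omega> \<in> space M" for \<omega>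
    using \<gamma>n_opt[OF that linear_policy_in_policies, of K] moments[OF that] K by simp
  have finG: "cost (gauss l) \<gamma>G < \<infinity>"
    using \<gamma>G_opt[OF linear_policy_in_policies, of K] fin M.not_empty by (metis equals0I order.strict_trans1)
  have "\<exists>E\<in>sets M. ?p \<le> M.prob E \<and>
    (\<forall>\<omega>\<in>E. ennreal (1 - \<epsilon>) * cost_on (\<gamma>n \<omega>) \<le> cost (law \<omega>) (\<gamma>n \<omega>))"
  \<comment> \<open>\<open>l = 0\<close> means that there are no agents, and every loss vanishes; Eldan-Klartag needs \<open>l \<ge> 1\<close>\<close>
  proof (cases "l = 0")
    case True
    then have "?loss \<gamma> y = 0" for \<gamma> y
      by (simp add: l_def total_dim_def square_loss_def qform_def)
    then show ?thesis
      using C by (intro bexI[of _ "space M"]) (auto simp: cost_on_def M.prob_space)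
  next
    case False
    then have l1: "1 \<le> l" by simp
    have "(real l powr (1 / c1)) powr c1 \<le> real n powr c1"
      using n(2) C by (intro powr_mono2) auto
    then have l2: "real l \<le> real n powr c1" using C by (simp add: powr_powr)
    have "indep_elements M (vec_borel n) (\<xi> n) (mat_borel n l) (R n)"
      using ensemble n(1) unfolding team_ensemble_def l_def
      by (intro indep_elements_project_swap[where I = "{total_dim m ls..}" and
            A = "\<lambda>k. mat_borel k (total_dim m ls)" and B = vec_borel, OF M]) auto
    from eldan_klartag_any_space[OF constants M isotropic[OF n(1)] log_concave[OF n(1)] l1 l2 R this]
    obtain E where E: "E \<in> sets M" "?p \<le> M.prob E"
      and good: "\<And>\<omega>. \<omega> \<in> E \<Longrightarrow> \<exists>f. (\<forall>x. 0 \<le> f x) \<and>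
        distributed M (vec_lborel l) (\<lambda>\<omega>'. (R n \<omega>)\<^sup>T *\<^sub>v \<xi> n \<omega>') (\<lambda>x. ennreal (f x)) \<and>
        (\<forall>x\<in>carrier_vec l. vec_norm x \<le> real n powr c4 \<longrightarrow>
          \<bar>f x / std_normal_vec_density l x - 1\<bar> \<le> \<epsilon>)"
      unfolding with_prob_at_least_def \<epsilon>_def by blast
    have "ennreal (1 - \<epsilon>) * cost_on (\<gamma>n \<omega>) \<le> cost (law \<omega>) (\<gamma>n \<omega>)" if \<omega>: "\<omega> \<in> E" for \<omega>
    proof -
      have \<omega>M: "\<omega> \<in> space M" using \<omega> E(1) sets.sets_into_space by blast
      obtain f where f: "\<And>x. 0 \<le> f x"
        "distributed M (vec_lborel l) (\<lambda>\<omega>'. (R n \<omega>)\<^sup>T *\<^sub>v \<xi> n \<omega>') (\<lambda>x. ennreal (f x))"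
        "\<And>x. x \<in> ?A \<Longrightarrow> \<bar>f x / std_normal_vec_density l x - 1\<bar> \<le> \<epsilon>"
        using good[OF \<omega>] by (auto simp: vec_ball_def)
      have "law \<omega> = distr M (vec_lborel l) (\<lambda>\<omega>'. (R n \<omega>)\<^sup>T *\<^sub>v \<xi> n \<omega>')"
        unfolding law_def by (rule distr_cong) simp_all
      also have "\<dots> = density (vec_lborel l) (\<lambda>x. ennreal (f x))"
        using f(2) by (rule distributed_distr_eq_density)
      finally have law: "law \<omega> = density (vec_lborel l) (\<lambda>x. ennreal (f x))" .
      have fm: "f \<in> borel_measurable (vec_borel l)"
        using distributed_real_measurable[OF f(1) f(2)] by (simp cong: measurable_cong_sets)
      show ?thesis
        unfolding cost_def cost_on_def law
        by (rule near_gauss_cost_lower_bound[OF f(1) fm f(3) n(3) vec_ball_measurable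
              square_loss_nonneg[OF Q] measurable_square_loss[OF Q \<gamma>n[OF \<omega>M], folded l_def]])
    qed
    with E show ?thesis by blast
  qed
  then obtain E where E: "E \<in> sets M" "?p \<le> M.prob E"
    and lower: "\<And>\<omega>. \<omega> \<in> E \<Longrightarrow> ennreal (1 - \<epsilon>) * cost_on (\<gamma>n \<omega>) \<le> cost (law \<omega>) (\<gamma>n \<omega>)"
    by blast
  show ?thesis
    unfolding with_prob_at_least_def
  proof (intro bexI[OF _ E(1)] conjI[OF E(2)] ballI conjI)
    fix \<omega> assume \<omega>: "\<omega> \<in> E"
    then have \<omega>M: "\<omega> \<in> space M" using E(1) sets.sets_into_space by blast
    show "team_cost m ls Q W (R n \<omega>) M (\<xi> n) (\<gamma>opt n (R n \<omega>)) \<le> gauss_cost m ls Q W N \<zeta> \<gamma>G"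
      using upper[OF \<omega>M] team[OF \<omega>M \<gamma>n[OF \<omega>M]] gc[OF \<gamma>G]
      by (simp add: \<gamma>n_def less_eq_ennreal.rep_eq)
    obtain g where g: "0 \<le> g" "cost (gauss l) \<gamma>G = ennreal g"
      using finG by (metis ennreal_cases infinity_ennreal_def less_irrefl)
    obtain j where j: "0 \<le> j" "cost (law \<omega>) (\<gamma>n \<omega>) = ennreal j" "j \<le> g"
      using upper[OF \<omega>M] g finG
      by (metis ennreal_cases ennreal_le_iff ennreal_neq_top top.extremum_unique)
    have "cost_on (\<gamma>n \<omega>) \<noteq> \<infinity>"
    proof
      assume "cost_on (\<gamma>n \<omega>) = \<infinity>"
      then have "ennreal (1 - \<epsilon>) * cost_on (\<gamma>n \<omega>) = \<infinity>"
        using n(3) by (simp add: ennreal_mult_top)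
      then show False using lower[OF \<omega>] j by (simp add: top_unique)
    qed
    then obtain c where c: "0 \<le> c" "cost_on (\<gamma>n \<omega>) = ennreal c"
      by (metis ennreal_cases infinity_ennreal_def)
    have "(1 - \<epsilon>) * c \<le> j"
      using lower[OF \<omega>] n(3) c j by (simp add: ennreal_mult[symmetric] ennreal_le_iff)
    then have "c \<le> j / (1 - \<epsilon>)" using n(3) by (simp add: field_simps)
    also have "\<dots> = j + \<epsilon> / (1 - \<epsilon>) * j" using n(3) by (simp add: field_simps)
    also have "\<dots> \<le> j + \<epsilon> / (1 - \<epsilon>) * g" using j(3) n(3) \<epsilon> by (intro add_left_mono mult_left_mono) auto
    finally have bound: "c - \<epsilon> / (1 - \<epsilon>) * g \<le> j" by simp
    have "gauss_value_on m ls Q W ?A N \<zeta> \<le> gauss_cost_on m ls Q W ?A N \<zeta> (\<gamma>n \<omega>)"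
      unfolding gauss_value_on_def by (rule INF_lower[OF \<gamma>n[OF \<omega>M]])
    also have "\<dots> = ereal c" using gco[OF \<gamma>n[OF \<omega>M]] c by simp
    finally have "gauss_value_on m ls Q W ?A N \<zeta> - ereal (\<epsilon> / (1 - \<epsilon>)) * ereal g
        \<le> ereal c - ereal (\<epsilon> / (1 - \<epsilon>)) * ereal g"
      by (intro ereal_minus_mono) auto
    also have "\<dots> \<le> ereal j" using bound by simp
    finally show "gauss_value_on m ls Q W ?A N \<zeta> - ereal (\<epsilon> / (1 - \<epsilon>)) * gauss_cost m ls Q W N \<zeta> \<gamma>G
        \<le> team_cost m ls Q W (R n \<omega>) M (\<xi> n) (\<gamma>opt n (R n \<omega>))"
      using team[OF \<omega>M \<gamma>n[OF \<omega>M]] gc[OF \<gamma>G] g j by (simp add: \<gamma>n_def)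
  qed
qed

end
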